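(* Let $\mathfrak{A}$ be an algebra in $\mathbb{P}^d$, let $\mathfrak{V}=\{x\in\mathbb{M}^{[d]} : p(x)=0 \text{ for all } p\in\mathfrak{A}\}$, and let $\delta$ be a $J\times J$ matrix of free polynomials such that $\mathfrak{V}\cap G_\delta$ is non-empty. Let $f$ be a bounded free holomorphic function defined on $\mathfrak{V}\cap G_\delta$. Then there is a free holomorphic function $\phi$ on $G_\delta$ that extends $f$ and such that $$\|\phi\|_{H^\infty(G_\delta)}=\sup_{x\in\mathfrak{V}\cap G_\delta}\|f(x)\|.$$
   Context: $\mathbb{M}_n$ is the set of $n\times n$ complex matrices, $\mathbb{M}_n^d$ is the set of $d$-tuples of $n\times n$ complex matrices, and $\mathbb{M}^{[d]}=\bigcup_{n\ge1}\mathbb{M}_n^d$. $\mathbb{P}^d$ is the (unital) algebra of free polynomials, i.e. complex polynomials in $d$ non-commuting variables. An algebra in $\mathbb{P}^d$ is a subalgebra of $\mathbb{P}^d$. Direct sums and similarities of $d$-tuples are taken coordinatewise. Norms of matrices are operator norms. For a $J\times J$ matrix $\delta$ with entries in $\mathbb{P}^d$ and $x\in\mathbb{M}_n^d$, $\delta(x)$ is regarded as an operator on $\mathbb{C}^n\otimes\mathbb{C}^J$, and $G_\delta=\{x\in\mathbb{M}^{[d]}:\|\delta(x)\|<1\}$; these sets are called basic free open sets, and they form a basis of the free topology on $\mathbb{M}^{[d]}$ (as $J$ and $\delta$ vary). A free open set is a set open in this topology. A graded function on a subset $D\subseteq\mathbb{M}^{[d]}$ is a function $\phi$ with $\phi(x)\in\mathbb{M}_n$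 whenever $x\in D\cap\mathbb{M}_n^d$. An nc-function on $D$ is a graded function $\phi$ such that (a) if $x,y,x\oplus y\in D$ then $\phi(x\oplus y)=\phi(x)\oplus\phi(y)$; (b) if $s\in\mathbb{M}_n$ is invertible and $x,s^{-1}xs\in D\cap\mathbb{M}_n^d$ then $\phi(s^{-1}xs)=s^{-1}\phi(x)s$. A free holomorphic function on a free open set $U$ is a function $\phi$ on $U$ such that for every $x\in U$ there is a basic free open set $G_{\delta'}\subseteq U$ containing $x$ such that $\phi|_{G_{\delta'}}$ is a bounded nc-function. $H^\infty(U)$ is the space of bounded free holomorphic functions on $U$ with norm $\|\phi\|_{H^\infty(U)}=\sup_{x\in U}\|\phi(x)\|$. For a free open set $U$ and $\mathfrak{V}$ as in the claim, a function $f$ defined on $\mathfrak{V}\cap U$ is called free holomorphic if for every $x\in\mathfrak{V}\cap U$ there are a basic free open set $G_{\delta'}\subseteq U$ containing $x$ and a free holomorphic function $\psi$ on $G_{\delta'}$ such that $\psi|_{\mathfrak{V}\cap G_{\delta'}}=f|_{\mathfrak{V}\cap G_{\delta'}}$. It is bounded if $\sup_{x\in\mathfrak{V}\cap U}\|f(x)\|<\infty$. *)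

theory Defs
  imports
    "Jordan_Normal_Form.Matrix"
    "HOL-Library.Poly_Mapping"
    "HOL-Analysis.Abstract_Topology"
    "HOL-Analysis.L2_Norm"
begin

section \<open>Free polynomials\<close>

text \<open>
  The variables are indexed by a finite type \<open>'d\<close>, so the number \<open>d \<ge> 1\<close> of variables is
  \<open>CARD('d)\<close>. Free polynomials form the monoid algebra over the complex numbers of the free monoid
  of words, written additively so that the convolution product of
  \<^theory>\<open>HOL-Library.Poly_Mapping\<close> is the (non-commutative) product of free polynomials.
\<close>

datatype 'd nc_word = Nc_Word (letters: "'d list")

instantiation nc_word :: (type) monoid_add
begin

definition zero_nc_word :: "'a nc_word" where
  "0 = Nc_Word []"

definition plus_nc_word :: "'a nc_word \<Rightarrow> 'a nc_word \<Rightarrow> 'a nc_word" where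
  "u + v = Nc_Word (letters u @ letters v)"

instance
  by standard (simp_all add: zero_nc_word_def plus_nc_word_def)

end

type_synonym 'd free_poly = "'d nc_word \<Rightarrow>\<^sub>0 complex"

text \<open>Subalgebras need not contain \<open>1\<close>: one that does has no common zeros.\<close>

definition nc_subalgebra :: "'d free_poly set \<Rightarrow> bool" where
  "nc_subalgebra A \<longleftrightarrow> 0 \<in> A
     \<and> (\<forall>p\<in>A. \<forall>q\<in>A. p + q \<in> A)
     \<and> (\<forall>c. \<forall>p\<in>A. Poly_Mapping.map ((*) c) p \<in> A)
     \<and> (\<forall>p\<in>A. \<forall>q\<in>A. p * q \<in> A)"


section \<open>Tuples of matrices and evaluation\<close>

type_synonym 'd nc_point = "'d \<Rightarrow> complex mat"

definition nc_level :: "nat \<Rightarrow> 'd nc_point set" where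
  "nc_level n = {x. \<forall>i. x i \<in> carrier_mat n n}"

definition mat_dsum :: "complex mat \<Rightarrow> complex mat \<Rightarrow> complex mat" where
  "mat_dsum a b = four_block_mat a (0\<^sub>m (dim_row a) (dim_col b)) (0\<^sub>m (dim_row b) (dim_col a)) b"

definition nc_dsum :: "'d nc_point \<Rightarrow> 'd nc_point \<Rightarrow> 'd nc_point" where
  "nc_dsum x y = (\<lambda>i. mat_dsum (x i) (y i))"

definition word_eval :: "nat \<Rightarrow> 'd nc_word \<Rightarrow> 'd nc_point \<Rightarrow> complex mat" where
  "word_eval n w x = foldr (\<lambda>i m. x i * m) (letters w) (1\<^sub>m n)"

text \<open>
  \<open>poly_eval n p x\<close> is \<open>p(x)\<close> for \<open>x\<close> in \<open>nc_level n\<close>. The sum over the words is taken entrywise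
  because matrices of varying size are not an instance of the class of commutative monoids.
\<close>

definition poly_eval :: "nat \<Rightarrow> 'd free_poly \<Rightarrow> 'd nc_point \<Rightarrow> complex mat" where
  "poly_eval n p x =
     mat n n (\<lambda>(i, j). \<Sum>w\<in>Poly_Mapping.keys p. Poly_Mapping.lookup p w * word_eval n w x $$ (i, j))"

text \<open>
  For \<open>\<delta>\<close> of size \<open>J \<times> J\<close> and \<open>x\<close> in \<open>nc_level n\<close>, \<open>\<delta>(x)\<close> acts on the tensor product of
  \<open>\<complex>\<^sup>n\<close> and \<open>\<complex>\<^sup>J\<close>; the basis vector \<open>e\<^sub>i \<otimes> e\<^sub>k\<close> has index \<open>i * J + k\<close>.
\<close>

definition mat_poly_eval :: "nat \<Rightarrow> 'd free_poly mat \<Rightarrow> 'd nc_point \<Rightarrow> complex mat" where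
  "mat_poly_eval n \<delta> x =
     mat (n * dim_row \<delta>) (n * dim_col \<delta>)
       (\<lambda>(r, c). poly_eval n (\<delta> $$ (r mod dim_row \<delta>, c mod dim_col \<delta>)) x
                   $$ (r div dim_row \<delta>, c div dim_col \<delta>))"

definition vec_norm2 :: "complex vec \<Rightarrow> real" where
  "vec_norm2 v = L2_set (\<lambda>i. cmod (v $ i)) {..<dim_vec v}"

definition mat_opnorm :: "complex mat \<Rightarrow> real" where
  "mat_opnorm a = (SUP v\<in>{v \<in> carrier_vec (dim_col a). vec_norm2 v \<le> 1}. vec_norm2 (a *\<^sub>v v))"


section \<open>The free topology\<close>

definition basic_free_set :: "'d free_poly mat \<Rightarrow> 'd nc_point set" where
  "basic_free_set \<delta> = {x. \<exists>n\<ge>1. x \<in> nc_level n \<and> mat_opnorm (mat_poly_eval n \<delta> x) < 1}"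

definition basic_free_open :: "'d nc_point set \<Rightarrow> bool" where
  "basic_free_open G \<longleftrightarrow> (\<exists>J\<ge>1. \<exists>\<delta>\<in>carrier_mat J J. G = basic_free_set \<delta>)"

text \<open>
  The basic free open sets are closed under binary intersection (take block diagonal matrices of
  polynomials), so they are a basis of the topology they generate.
\<close>

definition free_topology :: "'d nc_point topology" where
  "free_topology = topology_generated_by {G. basic_free_open G}"


section \<open>Free holomorphic functions\<close>

text \<open>
  Functions on a set \<open>D\<close> of points are total functions of which only the values on \<open>D\<close> matter.
\<close>

definition graded_on :: "'d nc_point set \<Rightarrow> ('d nc_point \<Rightarrow> complex mat) \<Rightarrow> bool" where
  "graded_on D \<phi> \<longleftrightarrow> (\<forall>n\<ge>1. \<forall>x\<in>D \<inter> nc_level n. \<phi> x \<in> carrier_mat n n)"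

text \<open>In the last clause \<open>t\<close> is the inverse of \<open>s\<close>.\<close>

definition nc_function_on :: "'d nc_point set \<Rightarrow> ('d nc_point \<Rightarrow> complex mat) \<Rightarrow> bool" where
  "nc_function_on D \<phi> \<longleftrightarrow> graded_on D \<phi>
     \<and> (\<forall>x y. x \<in> D \<and> y \<in> D \<and> nc_dsum x y \<in> D \<longrightarrow> \<phi> (nc_dsum x y) = mat_dsum (\<phi> x) (\<phi> y))
     \<and> (\<forall>n\<ge>1. \<forall>s\<in>carrier_mat n n. \<forall>t\<in>carrier_mat n n. \<forall>x.
          inverts_mat s t \<and> inverts_mat t s
          \<and> x \<in> D \<inter> nc_level n \<and> (\<lambda>i. t * x i * s) \<in> D \<inter> nc_level n
          \<longrightarrow> \<phi> (\<lambda>i. t * x i * s) = t * \<phi> x * s)"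

definition nc_bounded_on :: "'d nc_point set \<Rightarrow> ('d nc_point \<Rightarrow> complex mat) \<Rightarrow> bool" where
  "nc_bounded_on D \<phi> \<longleftrightarrow> bdd_above ((\<lambda>x. mat_opnorm (\<phi> x)) ` D)"

definition free_holomorphic_on :: "'d nc_point set \<Rightarrow> ('d nc_point \<Rightarrow> complex mat) \<Rightarrow> bool" where
  "free_holomorphic_on U \<phi> \<longleftrightarrow> openin free_topology U
     \<and> (\<forall>x\<in>U. \<exists>G. basic_free_open G \<and> x \<in> G \<and> G \<subseteq> U \<and> nc_function_on G \<phi> \<and> nc_bounded_on G \<phi>)"

definition Hinf :: "'d nc_point set \<Rightarrow> ('d nc_point \<Rightarrow> complex mat) set" where
  "Hinf U = {\<phi>. free_holomorphic_on U \<phi> \<and> nc_bounded_on U \<phi>}"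

definition Hinf_norm :: "'d nc_point set \<Rightarrow> ('d nc_point \<Rightarrow> complex mat) \<Rightarrow> real" where
  "Hinf_norm U \<phi> = (SUP x\<in>U. mat_opnorm (\<phi> x))"


section \<open>Free varieties\<close>

definition free_variety :: "'d free_poly set \<Rightarrow> 'd nc_point set" where
  "free_variety A = {x. \<exists>n\<ge>1. x \<in> nc_level n \<and> (\<forall>p\<in>A. poly_eval n p x = 0\<^sub>m n n)}"

text \<open>\<open>f\<close> is a free holomorphic function on \<open>V \<inter> U\<close>, where \<open>V\<close> is a free variety.\<close>

definition free_holomorphic_rel ::
  "'d nc_point set \<Rightarrow> 'd nc_point set \<Rightarrow> ('d nc_point \<Rightarrow> complex mat) \<Rightarrow> bool" where
  "free_holomorphic_rel V U f \<longleftrightarrow> openin free_topology U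
     \<and> (\<forall>x\<in>V \<inter> U. \<exists>G \<psi>. basic_free_open G \<and> x \<in> G \<and> G \<subseteq> U \<and> free_holomorphic_on G \<psi>
          \<and> (\<forall>y\<in>V \<inter> G. \<psi> y = f y))"

end

theory Submission
  imports Defs "Jordan_Normal_Form.Schur_Decomposition" "HOL-Analysis.Function_Topology"
begin

text \<open>
  Write \<open>W = V \<inter> G\<^sub>\<delta>\<close> for the domain of \<open>f\<close> and \<open>B\<close> for the supremum of its norm. As \<open>W\<close> is closed under direct sums,
  a function that is locally the restriction of nc functions is an nc function on all of \<open>W\<close>
  (\<open>free_holomorphic_rel_nc_function\<close>). What has to be found is an nc function on \<open>G\<^sub>\<delta>\<close> that extends \<open>f\<close> and is bounded
  by \<open>B\<close>: being bounded on the basic free open set \<open>G\<^sub>\<delta>\<close>, it is free holomorphic there.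

  Polynomials are nc functions, so it suffices to find enough polynomials and to pass to a limit. By compactness
  (\<open>bounded_nc_extension\<close>) it is enough to treat finitely many points and vectors at a time: there should be a
  polynomial \<open>q\<close> with prescribed value \<open>f(x)\<close> at one point \<open>x\<close> of \<open>W\<close>, and with \<open>|q(y)\<xi>|\<close> essentially at most \<open>B|\<xi>|\<close> for
  finitely many pairs \<open>(y, \<xi>)\<close> with \<open>y\<close> in \<open>G\<^sub>\<delta>\<close>. A minimax principle (\<open>common_negative_point\<close>) and direct sums
  reduce finitely many pairs to a single one (\<open>finite_interpolation\<close>).

  The heart of the matter is therefore a single pair (\<open>pointwise_interpolation\<close>). It rests on the idea behind the
  theorem that a quotient of an operator algebra by an ideal is again an operator algebra. The
  polynomials that vanish at \<open>x\<close> form an ideal, and the compression of \<open>y\<close> to a suitable semi-invariant subspace is a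
  tuple \<open>z\<close> on which this ideal vanishes, so that \<open>z\<close> is on the variety, while \<open>|\<delta>(z)| \<le> |\<delta>(y)| < 1\<close>. Thus \<open>z\<close> is
  in \<open>W\<close>, where \<open>f\<close> is bounded by \<open>B\<close>, and this bound is what controls \<open>q(y)\<xi>\<close>.

  To get from \<open>f\<close> to polynomials in the first place, one needs that the value of \<open>f\<close> at a point of \<open>W\<close> is the value of a
  polynomial there (\<open>nc_function_value_is_polynomial\<close>). This follows because nc functions respect intertwining
  relations (\<open>intertwining\<close>), hence invariant subspaces, and \<open>W\<close> is closed under restriction to invariant subspaces.
\<close>

section \<open>Evaluation of free polynomials\<close>

text \<open>
  Evaluation is entrywise the linear extension to polynomials of a function \<open>h\<close> on words. The
  rules for sums and products are proved once for such an extension.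
\<close>

lemma keys_sum_superset:
  assumes "finite S" "Poly_Mapping.keys p \<subseteq> S"
  shows "(\<Sum>w\<in>Poly_Mapping.keys p. Poly_Mapping.lookup p w * h w)
       = (\<Sum>w\<in>S. Poly_Mapping.lookup p w * (h w :: complex))"
  by (rule sum.mono_neutral_left) (use assms in \<open>auto simp: in_keys_iff\<close>)

lemma keys_sum_add:
  "(\<Sum>w\<in>Poly_Mapping.keys (p + q). Poly_Mapping.lookup (p + q) w * h w)
   = (\<Sum>w\<in>Poly_Mapping.keys p. Poly_Mapping.lookup p w * h w)
     + (\<Sum>w\<in>Poly_Mapping.keys q. Poly_Mapping.lookup q w * (h w :: complex))"
proof -
  let ?S = "Poly_Mapping.keys p \<union> Poly_Mapping.keys q"
  have "Poly_Mapping.keys (p + q) \<subseteq> ?S" by (rule keys_add)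
  then show ?thesis
    by (subst (1 2 3) keys_sum_superset[of ?S])
       (auto simp: lookup_add algebra_simps sum.distrib)
qed

lemma keys_sum_sum:
  "finite I \<Longrightarrow> (\<Sum>w\<in>Poly_Mapping.keys (\<Sum>i\<in>I. g i). Poly_Mapping.lookup (\<Sum>i\<in>I. g i) w * h w)
   = (\<Sum>i\<in>I. \<Sum>w\<in>Poly_Mapping.keys (g i). Poly_Mapping.lookup (g i) w * (h w :: complex))"
  by (induction I rule: finite_induct) (simp_all add: keys_sum_add)

lemma sum_of_monomials:
  "p = (\<Sum>w\<in>Poly_Mapping.keys p. Poly_Mapping.single w (Poly_Mapping.lookup p w))"
  by (rule poly_mapping_eqI)
     (auto simp: lookup_sum lookup_single when_def in_keys_iff)

lemma keys_sum_single:
  "(\<Sum>w\<in>Poly_Mapping.keys (Poly_Mapping.single u c). Poly_Mapping.lookup (Poly_Mapping.single u c) w * h w)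
   = c * (h u :: complex)"
  by simp

lemma keys_sum_mult:
  fixes p q :: "('w :: monoid_add) \<Rightarrow>\<^sub>0 complex"
  shows "(\<Sum>w\<in>Poly_Mapping.keys (p * q). Poly_Mapping.lookup (p * q) w * h w)
   = (\<Sum>u\<in>Poly_Mapping.keys p. \<Sum>v\<in>Poly_Mapping.keys q.
        Poly_Mapping.lookup p u * Poly_Mapping.lookup q v * h (u + v))"
proof -
  have "p * q = (\<Sum>u\<in>Poly_Mapping.keys p. \<Sum>v\<in>Poly_Mapping.keys q.
           Poly_Mapping.single (u + v) (Poly_Mapping.lookup p u * Poly_Mapping.lookup q v))"
    by (subst sum_of_monomials[of p], subst sum_of_monomials[of q])
       (simp add: sum_distrib_left sum_distrib_right mult_single sum.swap[of _ "Poly_Mapping.keys q"])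
  then show ?thesis
    by (simp only: keys_sum_sum finite_keys keys_sum_single)
qed

lemma nc_levelD: "x \<in> nc_level n \<Longrightarrow> x i \<in> carrier_mat n n"
  by (simp add: nc_level_def)

lemma word_eval_Nil [simp]: "word_eval n 0 x = 1\<^sub>m n" "word_eval n (Nc_Word []) x = 1\<^sub>m n"
  by (simp_all add: word_eval_def zero_nc_word_def)

lemma word_eval_Cons: "word_eval n (Nc_Word (i # us)) x = x i * word_eval n (Nc_Word us) x"
  by (simp add: word_eval_def)

lemma word_eval_carrier [simp]:
  "x \<in> nc_level n \<Longrightarrow> word_eval n w x \<in> carrier_mat n n"
proof (cases w)
  case (Nc_Word us)
  assume "x \<in> nc_level n"
  then have "word_eval n (Nc_Word us) x \<in> carrier_mat n n"
    by (induction us) (auto simp: word_eval_Cons dest: nc_levelD intro!: mult_carrier_mat)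
  then show ?thesis by (simp add: Nc_Word)
qed

lemma word_eval_add:
  assumes "x \<in> nc_level n"
  shows "word_eval n (u + v) x = word_eval n u x * word_eval n v x"
proof -
  have *: "word_eval n (Nc_Word (us @ letters v)) x = word_eval n (Nc_Word us) x * word_eval n v x" for us
  proof (induction us)
    case Nil
    then show ?case using word_eval_carrier[OF assms, of v] by (cases v) simp
  next
    case (Cons a us)
    then show ?case
      using assoc_mult_mat[OF nc_levelD[OF assms, of a] word_eval_carrier[OF assms] word_eval_carrier[OF assms]]
      by (simp add: word_eval_Cons)
  qed
  show ?thesis using *[of "letters u"] by (simp add: plus_nc_word_def)
qed

lemma poly_eval_carrier [simp]: "poly_eval n p x \<in> carrier_mat n n"
  "dim_row (poly_eval n p x) = n" "dim_col (poly_eval n p x) = n"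
  by (simp_all add: poly_eval_def)

lemma poly_eval_index:
  "i < n \<Longrightarrow> j < n \<Longrightarrow> poly_eval n p x $$ (i, j)
     = (\<Sum>w\<in>Poly_Mapping.keys p. Poly_Mapping.lookup p w * word_eval n w x $$ (i, j))"
  by (simp add: poly_eval_def)

lemma poly_eval_add: "poly_eval n (p + q) x = poly_eval n p x + poly_eval n q x"
  by (rule eq_matI) (simp_all add: poly_eval_index keys_sum_add)

lemma poly_eval_monom:
  "x \<in> nc_level n \<Longrightarrow> poly_eval n (Poly_Mapping.single w c) x = c \<cdot>\<^sub>m word_eval n w x"
  using word_eval_carrier[of x n w]
  by (intro eq_matI) (auto simp: poly_eval_index simp del: word_eval_carrier)

lemma poly_eval_one: "x \<in> nc_level n \<Longrightarrow> poly_eval n 1 x = 1\<^sub>m n"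
  using poly_eval_monom[of x n 0 1] by (auto intro!: eq_matI)

lemma index_mult_sum:
  assumes "A \<in> carrier_mat a m" "B \<in> carrier_mat m b" "i < a" "j < b"
  shows "(A * B) $$ (i, j) = (\<Sum>k<m. A $$ (i, k) * (B $$ (k, j)))"
  using assms by (simp add: scalar_prod_def lessThan_atLeast0)

lemma poly_eval_mult:
  assumes "x \<in> nc_level n"
  shows "poly_eval n (p * q) x = poly_eval n p x * poly_eval n q x"
proof (rule eq_matI)
  fix i j assume "i < dim_row (poly_eval n p x * poly_eval n q x)" "j < dim_col (poly_eval n p x * poly_eval n q x)"
  then have i: "i < n" and j: "j < n" by auto
  have "(poly_eval n p x * poly_eval n q x) $$ (i, j)
     = (\<Sum>k<n. \<Sum>u\<in>Poly_Mapping.keys p. \<Sum>v\<in>Poly_Mapping.keys q.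
          Poly_Mapping.lookup p u * Poly_Mapping.lookup q v * (word_eval n u x $$ (i,k) * word_eval n v x $$ (k,j)))"
    using i j by (subst index_mult_sum) (auto simp: poly_eval_index sum_product intro!: sum.cong)
  also have "\<dots> = (\<Sum>u\<in>Poly_Mapping.keys p. \<Sum>v\<in>Poly_Mapping.keys q.
        Poly_Mapping.lookup p u * Poly_Mapping.lookup q v *
          (\<Sum>k<n. word_eval n u x $$ (i,k) * word_eval n v x $$ (k,j)))"
    by (subst sum.swap, rule sum.cong, simp, subst sum.swap, rule sum.cong, simp) (simp add: sum_distrib_left)
  also have "\<dots> = poly_eval n (p * q) x $$ (i, j)"
    using i j assms
    by (simp add: poly_eval_index keys_sum_mult word_eval_add index_mult_sum[OF word_eval_carrier word_eval_carrier])
  finally show "poly_eval n (p * q) x $$ (i, j) = (poly_eval n p x * poly_eval n q x) $$ (i, j)" ..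
qed auto

lemma poly_eval_sandwich:
  assumes s: "s \<in> carrier_mat a m" and t: "t \<in> carrier_mat m b"
    and x: "x \<in> nc_level m" and i: "i < a" and j: "j < b"
  shows "(s * poly_eval m p x * t) $$ (i, j)
    = (\<Sum>w\<in>Poly_Mapping.keys p. Poly_Mapping.lookup p w * (s * word_eval m w x * t) $$ (i, j))"
proof -
  have *: "(s * A * t) $$ (i, j) = (\<Sum>l<m. \<Sum>k<m. s $$ (i, k) * A $$ (k, l) * t $$ (l, j))"
    if "A \<in> carrier_mat m m" for A
  proof -
    have "(s * A * t) $$ (i, j) = (\<Sum>l<m. (s * A) $$ (i, l) * t $$ (l, j))"
      using that s t i j by (intro index_mult_sum[of _ a m _ b]) auto
    also have "\<dots> = (\<Sum>l<m. (\<Sum>k<m. s $$ (i, k) * A $$ (k, l)) * t $$ (l, j))"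
      by (intro sum.cong refl) (use that s i in \<open>simp add: index_mult_sum[OF s that] del: index_mult_mat(1)\<close>)
    finally show ?thesis by (simp add: sum_distrib_right)
  qed
  show ?thesis
    unfolding *[OF poly_eval_carrier(1)] *[OF word_eval_carrier[OF x]]
    by (simp add: poly_eval_index sum_distrib_left sum_distrib_right sum.swap[of _ "Poly_Mapping.keys p"] mult_ac)
qed

text \<open>
  Intertwining relations between two tuples are checked on words and carried over to polynomials by
  linearity. All compressions and similarities below are instances.
\<close>

lemma poly_eval_sandwich_eq:
  assumes s: "s \<in> carrier_mat a m" and t: "t \<in> carrier_mat m b"
    and s': "s' \<in> carrier_mat a m'" and t': "t' \<in> carrier_mat m' b"
    and x: "x \<in> nc_level m" and x': "x' \<in> nc_level m'"
    and eq: "\<And>w. s * word_eval m w x * t = s' * word_eval m' w x' * t'"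
  shows "s * poly_eval m p x * t = s' * poly_eval m' p x' * t'"
proof (rule eq_matI)
  fix i j assume "i < dim_row (s' * poly_eval m' p x' * t')" "j < dim_col (s' * poly_eval m' p x' * t')"
  then have i: "i < a" and j: "j < b" using s' t' by auto
  show "(s * poly_eval m p x * t) $$ (i, j) = (s' * poly_eval m' p x' * t') $$ (i, j)"
    unfolding poly_eval_sandwich[OF s t x i j] poly_eval_sandwich[OF s' t' x' i j] eq ..
qed (use s t s' t' in auto)

lemma word_eval_similar:
  assumes x: "x \<in> nc_level n" and s: "s \<in> carrier_mat n n" and t: "t \<in> carrier_mat n n"
    and st: "s * t = 1\<^sub>m n" and ts: "t * s = 1\<^sub>m n"
  shows "word_eval n w (\<lambda>i. t * x i * s) = t * word_eval n w x * s"
proof -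
  have "word_eval n (Nc_Word us) (\<lambda>i. t * x i * s) = t * word_eval n (Nc_Word us) x * s" for us
  proof (induction us)
    case Nil
    then show ?case using t ts by simp
  next
    case (Cons i us)
    define a where "a = x i"
    define b where "b = word_eval n (Nc_Word us) x"
    have a: "a \<in> carrier_mat n n" and b: "b \<in> carrier_mat n n"
      using x nc_levelD by (auto simp: a_def b_def)
    have bs: "b * s \<in> carrier_mat n n" and ta: "t * a \<in> carrier_mat n n" and ab: "a * b \<in> carrier_mat n n"
      and tbs: "t * (b * s) \<in> carrier_mat n n"
      using a b s t by (auto intro!: mult_carrier_mat[of _ n n _ n])
    have "t * a * s * (t * b * s) = t * a * s * (t * (b * s))"
      unfolding assoc_mult_mat[OF t b s] ..
    also have "\<dots> = t * a * (s * (t * (b * s)))"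
      by (rule assoc_mult_mat[OF ta s tbs])
    also have "s * (t * (b * s)) = b * s"
      unfolding assoc_mult_mat[OF s t bs, symmetric] st by (rule left_mult_one_mat[OF bs])
    also have "t * a * (b * s) = t * (a * b) * s"
      unfolding assoc_mult_mat[OF t a bs] assoc_mult_mat[OF t ab s] assoc_mult_mat[OF a b s] ..
    finally show ?case using Cons by (simp add: word_eval_Cons a_def b_def)
  qed
  then show ?thesis by (cases w) simp
qed

lemma poly_eval_similar:
  assumes x: "x \<in> nc_level n" and s: "s \<in> carrier_mat n n" and t: "t \<in> carrier_mat n n"
    and st: "s * t = 1\<^sub>m n" and ts: "t * s = 1\<^sub>m n"
  shows "poly_eval n p (\<lambda>i. t * x i * s) = t * poly_eval n p x * s"
proof -
  have x': "(\<lambda>i. t * x i * s) \<in> nc_level n"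
    using x s t by (auto simp: nc_level_def intro!: mult_carrier_mat)
  have one: "1\<^sub>m n * a * 1\<^sub>m n = a" if "a \<in> carrier_mat n n" for a :: "complex mat"
    using that by simp
  have "1\<^sub>m n * poly_eval n p (\<lambda>i. t * x i * s) * 1\<^sub>m n = t * poly_eval n p x * s"
    by (rule poly_eval_sandwich_eq[OF one_carrier_mat one_carrier_mat t s x' x])
       (subst one[OF word_eval_carrier[OF x']], rule word_eval_similar[OF assms])
  then show ?thesis by (simp only: one[OF poly_eval_carrier(1)])
qed

section \<open>Direct sums\<close>

lemma mat_dsum_carrier [simp]:
  "a \<in> carrier_mat n n' \<Longrightarrow> b \<in> carrier_mat m m' \<Longrightarrow> mat_dsum a b \<in> carrier_mat (n + m) (n' + m')"
  by (simp add: mat_dsum_def four_block_carrier_mat)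

lemma mat_dsum_dim [simp]:
  "dim_row (mat_dsum a b) = dim_row a + dim_row b" "dim_col (mat_dsum a b) = dim_col a + dim_col b"
  by (simp_all add: mat_dsum_def)

lemma nc_dsum_level: "x \<in> nc_level n \<Longrightarrow> y \<in> nc_level m \<Longrightarrow> nc_dsum x y \<in> nc_level (n + m)"
  by (simp add: nc_level_def nc_dsum_def)

lemma mat_dsum_index:
  assumes "a \<in> carrier_mat n n'" "b \<in> carrier_mat m m'" "i < n + m" "j < n' + m'"
  shows "mat_dsum a b $$ (i, j) =
    (if i < n then (if j < n' then a $$ (i, j) else 0)
     else if j < n' then 0 else b $$ (i - n, j - n'))"
  using assms by (auto simp: mat_dsum_def)

lemma mat_dsum_mult:
  assumes "a \<in> carrier_mat n n'" "b \<in> carrier_mat m m'" "a' \<in> carrier_mat n' n''" "b' \<in> carrier_mat m' m''"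
  shows "mat_dsum a b * mat_dsum a' b' = mat_dsum (a * a') (b * b')"
  using assms unfolding mat_dsum_def
  by (subst mult_four_block_mat[of _ n n' _ m' _ m _ _ n'' _ m'']) (auto intro!: cong_four_block_mat)

lemma mat_dsum_mult_vec:
  assumes "a \<in> carrier_mat n n'" "b \<in> carrier_mat m m'" "u \<in> carrier_vec n'" "v \<in> carrier_vec m'"
  shows "mat_dsum a b *\<^sub>v (u @\<^sub>v v) = (a *\<^sub>v u) @\<^sub>v (b *\<^sub>v v)"
proof -
  have "0\<^sub>m n m' *\<^sub>v v = 0\<^sub>v n" "0\<^sub>m m n' *\<^sub>v u = 0\<^sub>v m"
    using assms by (auto intro!: eq_vecI simp: scalar_prod_def)
  then show ?thesis
  using assms unfolding mat_dsum_def
  by (subst four_block_mat_mult_vec[of _ n n' _ m' _ m]) auto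
qed

lemma mat_dsum_inj:
  assumes "mat_dsum a b = mat_dsum a' b'"
    and "a \<in> carrier_mat n n'" "b \<in> carrier_mat m m'" "a' \<in> carrier_mat n n'" "b' \<in> carrier_mat m m'"
  shows "a = a'" "b = b'"
proof -
  show "a = a'"
  proof (rule eq_matI)
    fix i j assume "i < dim_row a'" "j < dim_col a'"
    then show "a $$ (i, j) = a' $$ (i, j)"
      using assms mat_dsum_index[OF assms(2,3), of i j] mat_dsum_index[OF assms(4,5), of i j] by auto
  qed (use assms in auto)
  show "b = b'"
  proof (rule eq_matI)
    fix i j assume "i < dim_row b'" "j < dim_col b'"
    then show "b $$ (i, j) = b' $$ (i, j)"
      using assms mat_dsum_index[OF assms(2,3), of "n + i" "n' + j"] mat_dsum_index[OF assms(4,5), of "n + i" "n' + j"] by auto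
  qed (use assms in auto)
qed

lemma word_eval_dsum:
  assumes x: "x \<in> nc_level n" and y: "y \<in> nc_level m"
  shows "word_eval (n + m) w (nc_dsum x y) = mat_dsum (word_eval n w x) (word_eval m w y)"
proof -
  have "word_eval (n + m) (Nc_Word us) (nc_dsum x y)
      = mat_dsum (word_eval n (Nc_Word us) x) (word_eval m (Nc_Word us) y)" for us
  proof (induction us)
    case Nil
    then show ?case by (intro eq_matI) (auto simp: mat_dsum_index[of _ n n _ m m] mat_dsum_def)
  next
    case (Cons i us)
    then show ?case
      using mat_dsum_mult[OF nc_levelD[OF x] nc_levelD[OF y] word_eval_carrier[OF x] word_eval_carrier[OF y]]
      by (simp add: word_eval_Cons nc_dsum_def)
  qed
  then show ?thesis by (cases w) simp
qed

lemma poly_eval_dsum: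
  assumes x: "x \<in> nc_level n" and y: "y \<in> nc_level m"
  shows "poly_eval (n + m) p (nc_dsum x y) = mat_dsum (poly_eval n p x) (poly_eval m p y)"
proof -
  have D: "mat_dsum (poly_eval n p x) (poly_eval m p y) \<in> carrier_mat (n + m) (n + m)" by simp
  show ?thesis
  proof (rule eq_matI)
    fix i j assume "i < dim_row (mat_dsum (poly_eval n p x) (poly_eval m p y))"
      "j < dim_col (mat_dsum (poly_eval n p x) (poly_eval m p y))"
    then have "i < n + m" "j < n + m" using D by auto
    then show "poly_eval (n + m) p (nc_dsum x y) $$ (i, j)
        = mat_dsum (poly_eval n p x) (poly_eval m p y) $$ (i, j)"
      by (auto simp: poly_eval_index word_eval_dsum[OF assms] mat_dsum_index[of _ n n _ m m] x y)
  qed (use D in auto)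
qed

lemma mat_poly_eval_carrier [simp]:
  "\<delta> \<in> carrier_mat J J \<Longrightarrow> mat_poly_eval n \<delta> x \<in> carrier_mat (n * J) (n * J)"
  by (auto simp: mat_poly_eval_def)

text \<open>
  No permutation of the basis is needed: the basis vectors of \<open>\<complex>\<^sup>n \<otimes> \<complex>\<^sup>J\<close> are ordered with the
  index of \<open>\<complex>\<^sup>n\<close> first, so those of the first summand precede those of the second.
\<close>

lemma mat_poly_eval_dsum:
  assumes x: "x \<in> nc_level n" and y: "y \<in> nc_level m" and d: "\<delta> \<in> carrier_mat J J" and J: "J \<ge> 1"
  shows "mat_poly_eval (n + m) \<delta> (nc_dsum x y) = mat_dsum (mat_poly_eval n \<delta> x) (mat_poly_eval m \<delta> y)"
proof (rule eq_matI)
  let ?D = "mat_dsum (mat_poly_eval n \<delta> x) (mat_poly_eval m \<delta> y)"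
  have D: "?D \<in> carrier_mat (n * J + m * J) (n * J + m * J)" using d by simp
  fix r c assume "r < dim_row ?D" "c < dim_col ?D"
  then have r: "r < n * J + m * J" and c: "c < n * J + m * J" using D by auto
  have lt: "i div J < n \<longleftrightarrow> i < n * J" for i using J by (simp add: div_less_iff_less_mult)
  have lt2: "i div J < n + m" if "i < n * J + m * J" for i using J that by (simp add: div_less_iff_less_mult algebra_simps)
  have dm: "(i - n * J) div J = i div J - n" "(i - n * J) mod J = i mod J" if "\<not> i < n * J" for i
  proof -
    define k where "k = i - n * J"
    have k: "i = n * J + k" using that by (simp add: k_def)
    show "(i - n * J) div J = i div J - n" "(i - n * J) mod J = i mod J" using J by (simp_all add: k)
  qed
  have mod: "i mod J < J" for i using J by simp
  have lt3: "r - n * J < m * J" if "\<not> r < n * J" using r that by simp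
  have lt4: "c - n * J < m * J" if "\<not> c < n * J" using c that by simp
  show "mat_poly_eval (n + m) \<delta> (nc_dsum x y) $$ (r, c) = ?D $$ (r, c)"
    using r c d lt2[OF r] lt2[OF c] lt3 lt4
    by (subst mat_dsum_index[of _ "n*J" "n*J" _ "m * J" "m*J"])
       (auto simp: mat_poly_eval_def poly_eval_dsum[OF x y] mat_dsum_index[of _ n n _ m m] lt dm add_mult_distrib)
qed (use mat_dsum_carrier[OF mat_poly_eval_carrier[OF d] mat_poly_eval_carrier[OF d], of n x m y] d in \<open>auto simp: mat_poly_eval_def add_mult_distrib\<close>)

section \<open>Operator norm\<close>

text \<open>
  The squared norm is used because it is additive over direct sums of vectors, which turns weighted
  sums of norm conditions at several points into one condition at their direct sum.
\<close>

definition sqn :: "complex vec \<Rightarrow> real" where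
  "sqn v = (\<Sum>i<dim_vec v. (cmod (v $ i))\<^sup>2)"

lemma vec_norm2_sqn: "vec_norm2 v = sqrt (sqn v)"
  by (simp add: vec_norm2_def L2_set_def sqn_def)

lemma sqn_nonneg [simp]: "0 \<le> sqn v"
  by (simp add: sqn_def sum_nonneg)

lemma sqn_zero [simp]: "sqn (0\<^sub>v n) = 0"
  by (simp add: sqn_def)

lemma sqn_eq_0: "v \<in> carrier_vec n \<Longrightarrow> sqn v = 0 \<longleftrightarrow> v = 0\<^sub>v n"
  by (auto simp: sqn_def sum_nonneg_eq_0_iff intro!: eq_vecI)

lemma sqn_smult: "sqn (c \<cdot>\<^sub>v v) = (cmod c)\<^sup>2 * sqn v"
  by (simp add: sqn_def norm_mult power_mult_distrib sum_distrib_left)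

lemma sqn_unit_vec: "i < n \<Longrightarrow> sqn (unit_vec n i) = 1"
  by (simp add: sqn_def unit_vec_def if_distrib[of cmod] if_distrib[of "\<lambda>x. x ^ 2"] cong: if_cong)

lemma sqn_append: "sqn (u @\<^sub>v v) = sqn u + sqn v"
proof -
  have *: "(\<Sum>i<a + b. g i) = (\<Sum>i<a. g i) + (\<Sum>i<b. g (a + i))" for a b and g :: "nat \<Rightarrow> real"
    by (induction b) simp_all
  show ?thesis by (simp add: sqn_def *)
qed

lemma sqn_mult_entries:
  assumes "v \<in> carrier_vec (dim_col A)"
  shows "sqn (A *\<^sub>v v) \<le> (\<Sum>i<dim_row A. \<Sum>j<dim_col A. (cmod (A $$ (i, j)))\<^sup>2) * sqn v"
proof -
  have "(cmod ((A *\<^sub>v v) $ i))\<^sup>2 \<le> (\<Sum>j<dim_col A. (cmod (A $$ (i, j)))\<^sup>2) * sqn v"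
    if "i < dim_row A" for i
  proof -
    have "cmod ((A *\<^sub>v v) $ i) \<le> (\<Sum>j<dim_col A. cmod (A $$ (i, j)) * cmod (v $ j))"
      using assms that
      by (auto simp: scalar_prod_def lessThan_atLeast0 norm_mult intro!: sum_norm_le)
    also have "\<dots> \<le> L2_set (\<lambda>j. cmod (A $$ (i, j))) {..<dim_col A} * L2_set (\<lambda>j. cmod (v $ j)) {..<dim_col A}"
      using L2_set_mult_ineq[of "\<lambda>j. cmod (A $$ (i, j))" "\<lambda>j. cmod (v $ j)"] by simp
    also have "\<dots> = sqrt ((\<Sum>j<dim_col A. (cmod (A $$ (i, j)))\<^sup>2) * sqn v)"
      using assms by (simp add: L2_set_def sqn_def real_sqrt_mult)
    finally show ?thesis
      by (simp add: sqrt_ge_absD)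
  qed
  then show ?thesis
    unfolding sqn_def[of "A *\<^sub>v v"] sum_distrib_right[where A = "{..<dim_row A}"] by (auto intro!: sum_mono simp del: index_mult_mat_vec)
qed

text \<open>
  The operator norm is a supremum in the real numbers, so it means something only because the set
  of values is bounded; the Frobenius norm bounds it.
\<close>

lemma mat_opnorm_le_iff:
  assumes "0 \<le> c"
  shows "mat_opnorm A \<le> c \<longleftrightarrow> (\<forall>v\<in>carrier_vec (dim_col A). sqn (A *\<^sub>v v) \<le> c\<^sup>2 * sqn v)"
proof
  assume *: "\<forall>v\<in>carrier_vec (dim_col A). sqn (A *\<^sub>v v) \<le> c\<^sup>2 * sqn v"
  show "mat_opnorm A \<le> c"
    unfolding mat_opnorm_def
  proof (rule cSUP_least)
    show "{v \<in> carrier_vec (dim_col A). vec_norm2 v \<le> 1} \<noteq> {}"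
      by (auto simp: vec_norm2_sqn intro!: exI[of _ "0\<^sub>v (dim_col A)"])
    fix v assume "v \<in> {v \<in> carrier_vec (dim_col A). vec_norm2 v \<le> 1}"
    then have v: "v \<in> carrier_vec (dim_col A)" "sqn v \<le> 1" by (auto simp: vec_norm2_sqn)
    have "sqn (A *\<^sub>v v) \<le> c\<^sup>2 * sqn v" using * v by auto
    also have "\<dots> \<le> c\<^sup>2" using v mult_left_le[of "sqn v" "c\<^sup>2"] by simp
    finally show "vec_norm2 (A *\<^sub>v v) \<le> c" using assms by (simp add: vec_norm2_sqn real_le_lsqrt)
  qed
next
  assume le: "mat_opnorm A \<le> c"
  define K where "K = (\<Sum>i<dim_row A. \<Sum>j<dim_col A. (cmod (A $$ (i, j)))\<^sup>2)"
  have K: "0 \<le> K" by (simp add: K_def sum_nonneg)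
  have bdd: "bdd_above ((\<lambda>v. vec_norm2 (A *\<^sub>v v)) ` {v \<in> carrier_vec (dim_col A). vec_norm2 v \<le> 1})"
  proof (rule bdd_aboveI2)
    fix v assume "v \<in> {v \<in> carrier_vec (dim_col A). vec_norm2 v \<le> 1}"
    then have v: "v \<in> carrier_vec (dim_col A)" "sqn v \<le> 1" by (auto simp: vec_norm2_sqn)
    have "sqn (A *\<^sub>v v) \<le> K * sqn v" using sqn_mult_entries[OF v(1)] by (simp add: K_def)
    also have "\<dots> \<le> K" using v K mult_left_le[of "sqn v" K] by simp
    finally show "vec_norm2 (A *\<^sub>v v) \<le> sqrt K" by (simp add: vec_norm2_sqn)
  qed
  show "\<forall>v\<in>carrier_vec (dim_col A). sqn (A *\<^sub>v v) \<le> c\<^sup>2 * sqn v"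
  proof
    fix v :: "complex vec" assume v: "v \<in> carrier_vec (dim_col A)"
    show "sqn (A *\<^sub>v v) \<le> c\<^sup>2 * sqn v"
    proof (cases "sqn v = 0")
      case True
      then show ?thesis using sqn_mult_entries[OF v] by simp
    next
      case False
      then have pos: "0 < sqn v" using sqn_nonneg[of v] by linarith
      define r where "r = complex_of_real (1 / sqrt (sqn v))"
      have r: "(cmod r)\<^sup>2 = 1 / sqn v" using pos by (simp add: r_def norm_divide power_divide)
      have "vec_norm2 (A *\<^sub>v (r \<cdot>\<^sub>v v)) \<le> mat_opnorm A"
        unfolding mat_opnorm_def using v pos
        by (intro cSUP_upper[OF _ bdd]) (auto simp: vec_norm2_sqn sqn_smult r)
      then have "sqrt (sqn (A *\<^sub>v (r \<cdot>\<^sub>v v))) \<le> c" using le by (simp add: vec_norm2_sqn)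
      then have "sqn (A *\<^sub>v (r \<cdot>\<^sub>v v)) \<le> c\<^sup>2" using assms by (simp add: sqrt_le_D)
      also have "A *\<^sub>v (r \<cdot>\<^sub>v v) = r \<cdot>\<^sub>v (A *\<^sub>v v)" using v by (intro mult_mat_vec[of A "dim_row A" "dim_col A"]) auto
      finally show ?thesis using pos by (simp add: sqn_smult r divide_simps mult.commute)
    qed
  qed
qed

lemma mat_opnorm_nonneg: "0 \<le> mat_opnorm A"
proof (rule ccontr)
  assume neg: "\<not> 0 \<le> mat_opnorm A"
  have "mat_opnorm A \<le> 0 \<Longrightarrow> bdd_above ((\<lambda>v. vec_norm2 (A *\<^sub>v v)) ` {v \<in> carrier_vec (dim_col A). vec_norm2 v \<le> 1})"
    using mat_opnorm_le_iff[of 0 A] by (auto simp: vec_norm2_sqn intro!: bdd_aboveI2[of _ _ 0])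
  then have "vec_norm2 (A *\<^sub>v 0\<^sub>v (dim_col A)) \<le> mat_opnorm A"
    unfolding mat_opnorm_def using neg mat_opnorm_def
    by (intro cSUP_upper) (auto simp: vec_norm2_sqn)
  then show False using neg by (simp add: vec_norm2_sqn) (meson order_trans real_sqrt_ge_zero sqn_nonneg)
qed

lemma sqn_mult_le_opnorm:
  "v \<in> carrier_vec (dim_col A) \<Longrightarrow> sqn (A *\<^sub>v v) \<le> (mat_opnorm A)\<^sup>2 * sqn v"
  using mat_opnorm_le_iff[OF mat_opnorm_nonneg, of A A] by auto

lemma vec_append_split:
  assumes "v \<in> carrier_vec (n + m)"
  obtains a b where "a \<in> carrier_vec n" "b \<in> carrier_vec m" "v = a @\<^sub>v b"
  using assms that[of "vec_first v n" "vec_last v m"] by (simp add: vec_first_last_append)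

lemma mat_opnorm_dsum:
  assumes a: "a \<in> carrier_mat n n'" and b: "b \<in> carrier_mat m m'"
  shows "mat_opnorm (mat_dsum a b) = max (mat_opnorm a) (mat_opnorm b)"
proof (rule antisym)
  let ?c = "max (mat_opnorm a) (mat_opnorm b)"
  have c: "0 \<le> ?c" "(mat_opnorm a)\<^sup>2 \<le> ?c\<^sup>2" "(mat_opnorm b)\<^sup>2 \<le> ?c\<^sup>2"
    using mat_opnorm_nonneg[of a] mat_opnorm_nonneg[of b] by (auto intro!: power_mono)
  show "mat_opnorm (mat_dsum a b) \<le> ?c"
    unfolding mat_opnorm_le_iff[OF c(1)]
  proof
    fix v :: "complex vec" assume "v \<in> carrier_vec (dim_col (mat_dsum a b))"
    then obtain u w where u: "u \<in> carrier_vec n'" and w: "w \<in> carrier_vec m'" and v: "v = u @\<^sub>v w"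
      using a b by (auto elim!: vec_append_split)
    have "sqn (a *\<^sub>v u) \<le> ?c\<^sup>2 * sqn u"
      using sqn_mult_le_opnorm[of u a] u a mult_right_mono[OF c(2) sqn_nonneg[of u]] by auto
    moreover have "sqn (b *\<^sub>v w) \<le> ?c\<^sup>2 * sqn w"
      using sqn_mult_le_opnorm[of w b] w b mult_right_mono[OF c(3) sqn_nonneg[of w]] by auto
    ultimately show "sqn (mat_dsum a b *\<^sub>v v) \<le> ?c\<^sup>2 * sqn v"
      using a b u w by (simp add: v mat_dsum_mult_vec sqn_append distrib_left)
  qed
  let ?d = "mat_opnorm (mat_dsum a b)"
  have *: "sqn (a *\<^sub>v u) + sqn (b *\<^sub>v w) \<le> ?d\<^sup>2 * (sqn u + sqn w)"
    if "u \<in> carrier_vec n'" "w \<in> carrier_vec m'" for u w :: "complex vec"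
    using sqn_mult_le_opnorm[of "u @\<^sub>v w" "mat_dsum a b"] that a b
    by (simp add: mat_dsum_mult_vec sqn_append)
  have 0: "a *\<^sub>v 0\<^sub>v n' = 0\<^sub>v n" "b *\<^sub>v 0\<^sub>v m' = 0\<^sub>v m" using a b by auto
  have "mat_opnorm a \<le> ?d"
    unfolding mat_opnorm_le_iff[OF mat_opnorm_nonneg] using *[of _ "0\<^sub>v m'"] a by (auto simp: 0)
  moreover have "mat_opnorm b \<le> ?d"
    unfolding mat_opnorm_le_iff[OF mat_opnorm_nonneg] using *[of "0\<^sub>v n'"] b by (auto simp: 0)
  ultimately show "?c \<le> ?d" by simp
qed

section \<open>Isometries and subspaces\<close>

lemma mat_adjoint_carrier [simp]: "V \<in> carrier_mat m e \<Longrightarrow> mat_adjoint V \<in> carrier_mat e m"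
  unfolding mat_adjoint_def by auto

lemma mat_adjoint_dim [simp]: "dim_row (mat_adjoint V) = dim_col V" "dim_col (mat_adjoint V) = dim_row V"
  unfolding mat_adjoint_def by auto

lemma mat_adjoint_index [simp]:
  "i < dim_col V \<Longrightarrow> j < dim_row V \<Longrightarrow> mat_adjoint V $$ (i, j) = cnj (V $$ (j, i))"
  unfolding mat_adjoint_def by (subst mat_of_rows_index) simp_all

lemma mult_mat_vec_carrier_iff [simp]: "A *\<^sub>v v \<in> carrier_vec n \<longleftrightarrow> dim_row A = n"
proof
  assume "A *\<^sub>v v \<in> carrier_vec n"
  from carrier_vecD[OF this] show "dim_row A = n" by simp
qed (rule carrier_vecI, simp)

lemma cscalar_prod_sum: "v \<in> carrier_vec n \<Longrightarrow> u \<bullet>c v = (\<Sum>i<n. u $ i * cnj (v $ i))"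
  by (simp add: scalar_prod_def lessThan_atLeast0)

lemma cscalar_prod_self: "v \<bullet>c v = complex_of_real (sqn v)"
proof -
  have "v \<bullet>c v = (\<Sum>i<dim_vec v. v $ i * cnj (v $ i))" by (rule cscalar_prod_sum) simp
  also have "\<dots> = (\<Sum>i<dim_vec v. complex_of_real ((cmod (v $ i))\<^sup>2))"
    by (intro sum.cong refl) (rule complex_norm_square[symmetric])
  finally show ?thesis by (simp add: sqn_def)
qed

lemma index_mult_vec_sum:
  "A \<in> carrier_mat m e \<Longrightarrow> u \<in> carrier_vec e \<Longrightarrow> i < m \<Longrightarrow> (A *\<^sub>v u) $ i = (\<Sum>j<e. A $$ (i, j) * u $ j)"
  by (simp add: scalar_prod_def lessThan_atLeast0)

lemma cscalar_prod_adjoint: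
  fixes u w :: "complex vec"
  assumes V: "V \<in> carrier_mat m e" and u: "u \<in> carrier_vec e" and w: "w \<in> carrier_vec m"
  shows "(V *\<^sub>v u) \<bullet>c w = u \<bullet>c (mat_adjoint V *\<^sub>v w)"
proof -
  have "(V *\<^sub>v u) \<bullet>c w = (\<Sum>i<m. \<Sum>j<e. V $$ (i, j) * u $ j * cnj (w $ i))"
    by (simp add: cscalar_prod_sum[OF w] index_mult_vec_sum[OF V u] sum_distrib_right del: index_mult_mat_vec)
  also have "\<dots> = (\<Sum>j<e. u $ j * (\<Sum>i<m. V $$ (i, j) * cnj (w $ i)))"
    by (subst sum.swap) (simp add: sum_distrib_left mult_ac)
  also have "\<dots> = u \<bullet>c (mat_adjoint V *\<^sub>v w)"
    using V w by (subst cscalar_prod_sum[of _ e])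
      (auto simp: index_mult_vec_sum[of "mat_adjoint V" e m] simp del: index_mult_mat_vec intro!: sum.cong)
  finally show ?thesis .
qed

definition isometry :: "nat \<Rightarrow> nat \<Rightarrow> complex mat \<Rightarrow> bool" where
  "isometry e m V \<longleftrightarrow> V \<in> carrier_mat m e \<and> mat_adjoint V * V = 1\<^sub>m e"

lemma isometryD:
  assumes "isometry e m V"
  shows "V \<in> carrier_mat m e" "mat_adjoint V \<in> carrier_mat e m" "mat_adjoint V * V = 1\<^sub>m e"
    "u \<in> carrier_vec e \<Longrightarrow> mat_adjoint V *\<^sub>v (V *\<^sub>v u) = u"
proof -
  show *: "V \<in> carrier_mat m e" "mat_adjoint V \<in> carrier_mat e m" "mat_adjoint V * V = 1\<^sub>m e"
    using assms by (auto simp: isometry_def)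
  assume "u \<in> carrier_vec e"
  then show "mat_adjoint V *\<^sub>v (V *\<^sub>v u) = u"
    using assoc_mult_mat_vec[OF *(2,1), of u] *(3) by simp
qed

lemma isometry_sqn:
  assumes V: "isometry e m V" and u: "u \<in> carrier_vec e"
  shows "sqn (V *\<^sub>v u) = sqn u"
proof -
  have "complex_of_real (sqn (V *\<^sub>v u)) = (V *\<^sub>v u) \<bullet>c (V *\<^sub>v u)" by (simp only: cscalar_prod_self)
  also have "\<dots> = u \<bullet>c u"
    using isometryD[OF V] u
    by (subst cscalar_prod_adjoint[of _ m e]) (auto simp del: assoc_mult_mat_vec)
  finally show ?thesis by (simp only: cscalar_prod_self of_real_eq_iff)
qed

lemma isometry_adjoint_sqn:
  assumes V: "isometry e m V" and w: "w \<in> carrier_vec m"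
  shows "sqn (mat_adjoint V *\<^sub>v w) \<le> sqn w"
proof -
  note V' = isometryD[OF V]
  define a where "a = mat_adjoint V *\<^sub>v w"
  have a: "a \<in> carrier_vec e" using V' w by (simp add: a_def)
  define b where "b = w - V *\<^sub>v a"
  have b: "b \<in> carrier_vec m" using V' w a by (simp add: b_def)
  have "w = V *\<^sub>v a + b" using V' w a by (auto simp: b_def)
  then have "complex_of_real (sqn w) = \<dots> \<bullet>c \<dots>" by (simp only: cscalar_prod_self)
  also have "\<dots> = (V *\<^sub>v a) \<bullet>c (V *\<^sub>v a) + (V *\<^sub>v a) \<bullet>c b + b \<bullet>c (V *\<^sub>v a) + b \<bullet>c b"
    using V' a b by (simp add: conjugate_add_vec[of _ m] scalar_prod_add_distrib[of _ m] add_scalar_prod_distrib[of _ m])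
  also have "(V *\<^sub>v a) \<bullet>c b = 0"
  proof -
    have "mat_adjoint V *\<^sub>v b = a - a"
      unfolding b_def using V' w a
      by (subst mult_minus_distrib_mat_vec[of _ e m]) (auto simp: a_def simp del: assoc_mult_mat_vec)
    then show ?thesis using V' a b by (subst cscalar_prod_adjoint[of _ m e]) (auto simp: cscalar_prod_sum[of _ e])
  qed
  also have "b \<bullet>c (V *\<^sub>v a) = cnj ((V *\<^sub>v a) \<bullet>c b)"
    using V' a b by (subst (1 2) cscalar_prod_sum[of _ m]) (auto simp del: index_mult_mat_vec intro!: sum.cong)
  also have "(V *\<^sub>v a) \<bullet>c b = 0" by fact
  finally have "complex_of_real (sqn w) = complex_of_real (sqn (V *\<^sub>v a) + sqn b)"
    by (simp add: cscalar_prod_self)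
  then have "sqn w = sqn a + sqn b"
    unfolding isometry_sqn[OF V a] by (simp only: of_real_eq_iff)
  then show ?thesis using sqn_nonneg[of b] by (simp add: a_def)
qed

text \<open>
  The sum of the squared moduli of the entries is \<open>e\<close> by columns and at most \<open>m\<close> by rows.
\<close>

lemma isometry_dim_le:
  assumes V: "isometry e m V"
  shows "e \<le> m"
proof -
  note V' = isometryD[OF V]
  have row: "(\<Sum>j<e. (cmod (V $$ (i, j)))\<^sup>2) \<le> 1" if i: "i < m" for i
  proof -
    have "sqn (mat_adjoint V *\<^sub>v unit_vec m i) = (\<Sum>j<e. (cmod (V $$ (i, j)))\<^sup>2)"
      using V' i by (auto simp: sqn_def intro!: sum.cong)
    then show ?thesis using isometry_adjoint_sqn[OF V, of "unit_vec m i"] sqn_unit_vec[OF i] by simp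
  qed
  have col: "(\<Sum>i<m. (cmod (V $$ (i, j)))\<^sup>2) = 1" if j: "j < e" for j
  proof -
    have "(\<Sum>i<m. (cmod (V $$ (i, j)))\<^sup>2) = sqn (V *\<^sub>v unit_vec e j)"
      using V' j by (auto simp: sqn_def intro!: sum.cong)
    also have "\<dots> = 1" using isometry_sqn[OF V] sqn_unit_vec[OF j] by simp
    finally show ?thesis .
  qed
  have "real e = (\<Sum>j<e. \<Sum>i<m. (cmod (V $$ (i, j)))\<^sup>2)" using col by simp
  also have "\<dots> = (\<Sum>i<m. \<Sum>j<e. (cmod (V $$ (i, j)))\<^sup>2)" by (rule sum.swap)
  also have "\<dots> \<le> (\<Sum>i<m. 1)" by (rule sum_mono) (use row in simp)
  finally show ?thesis by simp
qed

definition subspace_vec :: "nat \<Rightarrow> complex vec set \<Rightarrow> bool" where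
  "subspace_vec m L \<longleftrightarrow> L \<subseteq> carrier_vec m \<and> 0\<^sub>v m \<in> L \<and> (\<forall>u\<in>L. \<forall>v\<in>L. u + v \<in> L) \<and> (\<forall>c. \<forall>u\<in>L. c \<cdot>\<^sub>v u \<in> L)"

text \<open>
  One step of Gram--Schmidt: a unit vector orthogonal to the range is appended as a new column.
\<close>

lemma isometry_snoc:
  assumes V: "isometry e m V" and w: "w \<in> carrier_vec m" "sqn w = 1" "mat_adjoint V *\<^sub>v w = 0\<^sub>v e"
  shows "isometry (Suc e) m (mat m (Suc e) (\<lambda>(i, j). if j < e then V $$ (i, j) else w $ i))"
    (is "isometry _ _ ?W")
proof -
  note V' = isometryD[OF V]
  have VV: "(\<Sum>i<m. cnj (V $$ (i, a)) * V $$ (i, b)) = (if a = b then 1 else 0)" if "a < e" "b < e" for a b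
  proof -
    have "(\<Sum>i<m. cnj (V $$ (i, a)) * V $$ (i, b)) = (mat_adjoint V * V) $$ (a, b)"
      using V' that by (subst index_mult_sum[of _ e m _ e]) auto
    then show ?thesis using V' that by simp
  qed
  have Vw: "(\<Sum>i<m. cnj (V $$ (i, a)) * w $ i) = 0" if "a < e" for a
  proof -
    have "(\<Sum>i<m. cnj (V $$ (i, a)) * w $ i) = (mat_adjoint V *\<^sub>v w) $ a"
      using V' w(1) that by (subst index_mult_vec_sum[of _ e m]) auto
    then show ?thesis using w that by simp
  qed
  have wV: "(\<Sum>i<m. cnj (w $ i) * V $$ (i, a)) = 0" if "a < e" for a
    using arg_cong[OF Vw[OF that], of cnj] by (simp add: mult.commute)
  have ww: "(\<Sum>i<m. cnj (w $ i) * w $ i) = 1"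
    using w cscalar_prod_self[of w] by (simp add: cscalar_prod_sum[OF w(1)] mult.commute)
  have "mat_adjoint ?W * ?W = 1\<^sub>m (Suc e)"
  proof (rule eq_matI)
    fix a b assume "a < dim_row (1\<^sub>m (Suc e) :: complex mat)" "b < dim_col (1\<^sub>m (Suc e) :: complex mat)"
    then have ab: "a < Suc e" "b < Suc e" by auto
    show "(mat_adjoint ?W * ?W) $$ (a, b) = 1\<^sub>m (Suc e) $$ (a, b)"
      using ab VV Vw wV ww
      by (subst index_mult_sum[of _ "Suc e" m _ "Suc e"]) (auto simp: less_Suc_eq)
  qed auto
  then show ?thesis by (simp add: isometry_def)
qed

text \<open>
  Take an isometry into \<open>L\<close> with as many columns as possible; if a vector of \<open>L\<close> were not fixed by
  the projection onto the range, its normalised remainder could be appended.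
\<close>

lemma isometry_onto_subspace:
  assumes L: "subspace_vec m L"
  obtains e V where "isometry e m V" "\<And>u. u \<in> carrier_vec e \<Longrightarrow> V *\<^sub>v u \<in> L"
    "\<And>v. v \<in> L \<Longrightarrow> V *\<^sub>v (mat_adjoint V *\<^sub>v v) = v"
proof -
  define P where "P e \<longleftrightarrow> (\<exists>V. isometry e m V \<and> (\<forall>u\<in>carrier_vec e. V *\<^sub>v u \<in> L))" for e
  have "isometry 0 m (0\<^sub>m m 0)" by (auto simp: isometry_def intro!: eq_matI)
  moreover have "0\<^sub>m m 0 *\<^sub>v u = 0\<^sub>v m" if "u \<in> carrier_vec 0" for u :: "complex vec"
    using that by (auto intro!: eq_vecI simp: scalar_prod_def)
  ultimately have "P 0" unfolding P_def using L by (auto simp: subspace_vec_def)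
  moreover have "\<forall>e. P e \<longrightarrow> e \<le> m" using isometry_dim_le by (auto simp: P_def)
  ultimately obtain e where e: "P e" "\<And>e'. P e' \<Longrightarrow> e' \<le> e"
    using Greatest_le_nat[of P _ m] GreatestI_nat[of P 0 m] by metis
  then obtain V where V: "isometry e m V" and VL: "\<And>u. u \<in> carrier_vec e \<Longrightarrow> V *\<^sub>v u \<in> L"
    by (auto simp: P_def)
  note V' = isometryD[OF V]
  have "V *\<^sub>v (mat_adjoint V *\<^sub>v v) = v" if v: "v \<in> L" for v
  proof (rule ccontr)
    assume ne: "V *\<^sub>v (mat_adjoint V *\<^sub>v v) \<noteq> v"
    have vc: "v \<in> carrier_vec m" using v L by (auto simp: subspace_vec_def)
    define a where "a = mat_adjoint V *\<^sub>v v"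
    have a: "a \<in> carrier_vec e" using V' vc by (simp add: a_def)
    define w where "w = v + (-1) \<cdot>\<^sub>v (V *\<^sub>v a)"
    have wL: "w \<in> L" using L v VL[OF a] by (simp add: w_def subspace_vec_def)
    then have wc: "w \<in> carrier_vec m" using L by (auto simp: subspace_vec_def)
    have w0: "sqn w \<noteq> 0"
    proof
      assume "sqn w = 0"
      then have "w = 0\<^sub>v m" using sqn_eq_0[OF wc] by simp
      then have "(v + (-1) \<cdot>\<^sub>v (V *\<^sub>v a)) $ i = 0" if "i < m" for i using that by (simp add: w_def)
      then have "V *\<^sub>v a = v" using V' vc a by (intro eq_vecI) auto
      then show False using ne by (simp add: a_def)
    qed
    have Vw: "mat_adjoint V *\<^sub>v w = 0\<^sub>v e"
    proof -
      have "mat_adjoint V *\<^sub>v w = a + (-1) \<cdot>\<^sub>v (mat_adjoint V *\<^sub>v (V *\<^sub>v a))"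
        unfolding w_def using V' vc a
        by (subst mult_add_distrib_mat_vec[of _ e m]) (auto simp: a_def mult_mat_vec[of _ e m] simp del: assoc_mult_mat_vec)
      also have "\<dots> = 0\<^sub>v e" unfolding V'(4)[OF a] using a by (intro eq_vecI) auto
      finally show ?thesis .
    qed
    define r where "r = complex_of_real (1 / sqrt (sqn w))"
    define w' where "w' = r \<cdot>\<^sub>v w"
    have r: "(cmod r)\<^sup>2 = 1 / sqn w" by (simp add: r_def norm_divide power_divide)
    have w': "w' \<in> carrier_vec m" "sqn w' = 1" "mat_adjoint V *\<^sub>v w' = 0\<^sub>v e" "w' \<in> L"
      using wc w0 Vw V' wL L by (auto simp: w'_def sqn_smult r mult_mat_vec[of _ e m] subspace_vec_def)
    let ?W = "mat m (Suc e) (\<lambda>(i, j). if j < e then V $$ (i, j) else w' $ i)"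
    have "?W *\<^sub>v u \<in> L" if u: "u \<in> carrier_vec (Suc e)" for u
    proof -
      have "?W *\<^sub>v u = V *\<^sub>v vec e (\<lambda>i. u $ i) + u $ e \<cdot>\<^sub>v w'"
        using u w' V' by (intro eq_vecI)
          (auto simp: index_mult_vec_sum[of ?W m "Suc e"] index_mult_vec_sum[of V m e] simp del: index_mult_mat_vec)
      then show ?thesis using VL[of "vec e (\<lambda>i. u $ i)"] w' L by (simp add: subspace_vec_def)
    qed
    then have "P (Suc e)" using isometry_snoc[OF V w'(1,2,3)] by (auto simp: P_def)
    then show False using e(2)[of "Suc e"] by simp
  qed
  then show ?thesis using that V VL by blast
qed

lemma subspace_vecD:
  assumes "subspace_vec m L"
  shows "v \<in> L \<Longrightarrow> v \<in> carrier_vec m" "0\<^sub>v m \<in> L" "u \<in> L \<Longrightarrow> v \<in> L \<Longrightarrow> u + v \<in> L" "u \<in> L \<Longrightarrow> c \<cdot>\<^sub>v u \<in> L"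
  using assms by (auto simp: subspace_vec_def)

text \<open>
  Adjoints are taken in \<open>U\<^sup>* V = 0\<close>, with the product expressed by its action on vectors.
\<close>

lemma orthogonal_isometries_sym:
  assumes V: "isometry e m V" and U: "isometry k m U"
    and orth: "\<And>w. w \<in> carrier_vec e \<Longrightarrow> mat_adjoint U *\<^sub>v (V *\<^sub>v w) = 0\<^sub>v k"
    and u: "u \<in> carrier_vec k"
  shows "mat_adjoint V *\<^sub>v (U *\<^sub>v u) = 0\<^sub>v e"
proof -
  note V' = isometryD[OF V] and U' = isometryD[OF U]
  define w where "w = mat_adjoint V *\<^sub>v (U *\<^sub>v u)"
  have w: "w \<in> carrier_vec e" using V' by (auto simp: w_def)
  have Vw: "V *\<^sub>v w \<in> carrier_vec m" and Uu: "U *\<^sub>v u \<in> carrier_vec m" using V' U' by auto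
  have "complex_of_real (sqn w) = w \<bullet>c w" by (simp only: cscalar_prod_self)
  also have "\<dots> = (V *\<^sub>v w) \<bullet>c (U *\<^sub>v u)"
    using cscalar_prod_adjoint[OF V'(1) w Uu] by (simp only: w_def)
  also have "\<dots> = cnj ((U *\<^sub>v u) \<bullet>c (V *\<^sub>v w))"
    unfolding cscalar_prod_sum[OF Vw] cscalar_prod_sum[OF Uu] by (simp add: mult.commute)
  also have "(U *\<^sub>v u) \<bullet>c (V *\<^sub>v w) = 0"
    using cscalar_prod_adjoint[OF U'(1) u Vw] orth[OF w] u by (simp add: cscalar_prod_sum[of _ k])
  finally have "sqn w = 0" by simp
  then show ?thesis using sqn_eq_0[OF w] by (simp add: w_def)
qed

text \<open>
  With an isometry \<open>U\<close> onto \<open>N\<close>, the vectors of \<open>M\<close> killed by \<open>U\<^sup>*\<close> form the orthogonal complement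
  of \<open>N\<close> in \<open>M\<close>, and \<open>V\<close> is an isometry onto it. The last conclusion is the resulting decomposition of \<open>M\<close>.
\<close>

lemma isometry_onto_complement:
  assumes M: "subspace_vec m M" and N: "subspace_vec m N" and NM: "N \<subseteq> M"
  obtains e V where "isometry e m V" "\<And>u. u \<in> carrier_vec e \<Longrightarrow> V *\<^sub>v u \<in> M"
    "\<And>n. n \<in> N \<Longrightarrow> mat_adjoint V *\<^sub>v n = 0\<^sub>v e"
    "\<And>v. v \<in> M \<Longrightarrow> \<exists>n\<in>N. v = V *\<^sub>v (mat_adjoint V *\<^sub>v v) + n"
proof -
  obtain k U where U: "isometry k m U" and UN: "\<And>u. u \<in> carrier_vec k \<Longrightarrow> U *\<^sub>v u \<in> N"
    and UU: "\<And>v. v \<in> N \<Longrightarrow> U *\<^sub>v (mat_adjoint U *\<^sub>v v) = v"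
    using isometry_onto_subspace[OF N] by metis
  note U' = isometryD[OF U]
  define E where "E = {v \<in> M. mat_adjoint U *\<^sub>v v = 0\<^sub>v k}"
  have E: "subspace_vec m E"
    unfolding subspace_vec_def
  proof (intro conjI ballI allI)
    show "E \<subseteq> carrier_vec m" using subspace_vecD(1)[OF M] by (auto simp: E_def)
    show "0\<^sub>v m \<in> E" using U' subspace_vecD(2)[OF M] by (auto simp: E_def)
    fix u assume u: "u \<in> E"
    note um = subspace_vecD(1)[OF M, of u]
    { fix v assume v: "v \<in> E"
      show "u + v \<in> E"
        using u v subspace_vecD(3)[OF M] um subspace_vecD(1)[OF M, of v]
        by (auto simp: E_def mult_add_distrib_mat_vec[OF U'(2)]) }
    fix c show "c \<cdot>\<^sub>v u \<in> E"
      using u subspace_vecD(4)[OF M] um by (auto simp: E_def mult_mat_vec[OF U'(2)])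
  qed
  obtain e V where V: "isometry e m V" and VE: "\<And>u. u \<in> carrier_vec e \<Longrightarrow> V *\<^sub>v u \<in> E"
    and VV: "\<And>v. v \<in> E \<Longrightarrow> V *\<^sub>v (mat_adjoint V *\<^sub>v v) = v"
    using isometry_onto_subspace[OF E] by metis
  note V' = isometryD[OF V]
  have VN: "mat_adjoint V *\<^sub>v n = 0\<^sub>v e" if n: "n \<in> N" for n
  proof -
    have "mat_adjoint V *\<^sub>v (U *\<^sub>v (mat_adjoint U *\<^sub>v n)) = 0\<^sub>v e"
      by (rule orthogonal_isometries_sym[OF V U]) (use VE U' in \<open>auto simp: E_def\<close>)
    then show ?thesis unfolding UU[OF n] .
  qed
  have "\<exists>n\<in>N. v = V *\<^sub>v (mat_adjoint V *\<^sub>v v) + n" if v: "v \<in> M" for v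
  proof -
    have vc: "v \<in> carrier_vec m" using subspace_vecD(1)[OF M v] .
    define n where "n = U *\<^sub>v (mat_adjoint U *\<^sub>v v)"
    have n: "n \<in> N" unfolding n_def using UN U' by simp
    have nc: "n \<in> carrier_vec m" using subspace_vecD(1)[OF N n] .
    define w where "w = v + (-1) \<cdot>\<^sub>v n"
    have wM: "w \<in> M" unfolding w_def using subspace_vecD(3,4)[OF M] v n NM by blast
    have adj: "mat_adjoint U *\<^sub>v w = mat_adjoint U *\<^sub>v v + (-1) \<cdot>\<^sub>v (mat_adjoint U *\<^sub>v n)"
      unfolding w_def using vc nc by (simp add: mult_add_distrib_mat_vec[OF U'(2)] mult_mat_vec[OF U'(2)])
    have "mat_adjoint U *\<^sub>v n = mat_adjoint U *\<^sub>v v" unfolding n_def by (rule U'(4)) (use U'(1) in simp)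
    then have "mat_adjoint U *\<^sub>v w = 0\<^sub>v k" unfolding adj using U' by (intro eq_vecI) auto
    then have "w \<in> E" using wM by (simp add: E_def)
    then have w: "V *\<^sub>v (mat_adjoint V *\<^sub>v w) = w" by (rule VV)
    have "mat_adjoint V *\<^sub>v w = mat_adjoint V *\<^sub>v v + (-1) \<cdot>\<^sub>v (mat_adjoint V *\<^sub>v n)"
      unfolding w_def using vc nc by (simp add: mult_add_distrib_mat_vec[OF V'(2)] mult_mat_vec[OF V'(2)])
    also have "\<dots> = mat_adjoint V *\<^sub>v v" unfolding VN[OF n] using V' by (intro eq_vecI) auto
    finally have "V *\<^sub>v (mat_adjoint V *\<^sub>v v) = w" using w by simp
    moreover have "v = w + n" using vc nc by (intro eq_vecI) (auto simp: w_def)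
    ultimately show ?thesis using n by blast
  qed
  then show ?thesis using that[OF V _ VN] VE by (simp add: E_def)
qed

section \<open>Compressions of points\<close>

text \<open>
  The block operator \<open>(F k l)\<close> on \<open>\<complex>\<^sup>n \<otimes> \<complex>\<^sup>J\<close> in the index convention of \<^const>\<open>mat_poly_eval\<close>. It
  covers both the evaluation of a matrix of polynomials and the operators \<open>s \<otimes> 1\<close>.
\<close>

definition big_mat :: "nat \<Rightarrow> nat \<Rightarrow> nat \<Rightarrow> (nat \<Rightarrow> nat \<Rightarrow> complex mat) \<Rightarrow> complex mat" where
  "big_mat n m J F = mat (n * J) (m * J) (\<lambda>(r, c). F (r mod J) (c mod J) $$ (r div J, c div J))"

definition tensor_id :: "nat \<Rightarrow> complex mat \<Rightarrow> complex mat" where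
  "tensor_id J s = big_mat (dim_row s) (dim_col s) J (\<lambda>k l. if k = l then s else 0\<^sub>m (dim_row s) (dim_col s))"

lemma big_mat_dim [simp]:
  "dim_row (big_mat n m J F) = n * J" "dim_col (big_mat n m J F) = m * J"
  "big_mat n m J F \<in> carrier_mat (n * J) (m * J)"
  by (simp_all add: big_mat_def)

lemma big_mat_index:
  "r < n * J \<Longrightarrow> c < m * J \<Longrightarrow> big_mat n m J F $$ (r, c) = F (r mod J) (c mod J) $$ (r div J, c div J)"
  by (simp add: big_mat_def)

lemma mat_poly_eval_big_mat:
  "\<delta> \<in> carrier_mat J J \<Longrightarrow> mat_poly_eval n \<delta> x = big_mat n n J (\<lambda>k l. poly_eval n (\<delta> $$ (k, l)) x)"
  by (simp add: mat_poly_eval_def big_mat_def)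

lemma sum_div_mod:
  fixes g :: "nat \<Rightarrow> nat \<Rightarrow> complex"
  shows "(\<Sum>q<n * J. g (q div J) (q mod J)) = (\<Sum>i<n. \<Sum>k<J. g i k)"
proof -
  have "(\<Sum>q<n * J. g (q div J) (q mod J)) = (\<Sum>i<n. \<Sum>q\<in>{i * J..<i * J + J}. g (q div J) (q mod J))"
    by (rule sum.nat_group[symmetric])
  also have "\<dots> = (\<Sum>i<n. \<Sum>k<J. g i k)"
  proof (rule sum.cong[OF refl])
    fix i
    have "(\<Sum>q\<in>{i * J..<i * J + J}. g (q div J) (q mod J)) = (\<Sum>k\<in>{0..<J}. g ((k + i * J) div J) ((k + i * J) mod J))"
      using sum.shift_bounds_nat_ivl[of "\<lambda>q. g (q div J) (q mod J)" 0 "i * J" J] by (simp add: add.commute)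
    then show "(\<Sum>q\<in>{i * J..<i * J + J}. g (q div J) (q mod J)) = (\<Sum>k<J. g i k)"
      by (simp add: lessThan_atLeast0)
  qed
  finally show ?thesis .
qed

lemma div_mod_less:
  assumes "r < n * (J :: nat)"
  shows "r div J < n" "r mod J < J"
  using assms by (cases "J = 0"; simp add: div_less_iff_less_mult)+

lemma tensor_id_mult_big_mat:
  assumes s: "s \<in> carrier_mat a n" and F: "\<And>k l. k < J \<Longrightarrow> l < J \<Longrightarrow> F k l \<in> carrier_mat n b"
  shows "tensor_id J s * big_mat n b J F = big_mat a b J (\<lambda>k l. s * F k l)"
proof (rule eq_matI)
  fix r c assume "r < dim_row (big_mat a b J (\<lambda>k l. s * F k l))" "c < dim_col (big_mat a b J (\<lambda>k l. s * F k l))"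
  then have r: "r < a * J" and c: "c < b * J" by auto
  note rc = div_mod_less[OF r] div_mod_less[OF c]
  have T: "tensor_id J s \<in> carrier_mat (a * J) (n * J)" using s by (auto simp: tensor_id_def)
  have "(tensor_id J s * big_mat n b J F) $$ (r, c)
      = (\<Sum>q<n * J. tensor_id J s $$ (r, q) * big_mat n b J F $$ (q, c))"
    using T r c by (intro index_mult_sum[of _ "a * J" "n * J" _ "b * J"]) auto
  also have "\<dots> = (\<Sum>q<n * J. (\<lambda>i k. (if r mod J = k then s $$ (r div J, i) else 0) * F k (c mod J) $$ (i, c div J)) (q div J) (q mod J))"
    using s r c rc by (intro sum.cong refl) (auto simp: tensor_id_def big_mat_index div_mod_less)
  also have "\<dots> = (\<Sum>i<n. \<Sum>k<J. (if r mod J = k then s $$ (r div J, i) else 0) * F k (c mod J) $$ (i, c div J))"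
    by (rule sum_div_mod)
  also have "\<dots> = (\<Sum>i<n. s $$ (r div J, i) * F (r mod J) (c mod J) $$ (i, c div J))"
    using rc by (simp add: if_distrib[of "\<lambda>x. x * _"] sum.delta cong: if_cong)
  also have "\<dots> = (s * F (r mod J) (c mod J)) $$ (r div J, c div J)"
    using rc by (intro index_mult_sum[symmetric, OF s F]) auto
  finally show "(tensor_id J s * big_mat n b J F) $$ (r, c) = big_mat a b J (\<lambda>k l. s * F k l) $$ (r, c)"
    using r c by (simp add: big_mat_index)
qed (use s in \<open>auto simp: tensor_id_def\<close>)

lemma big_mat_mult_tensor_id:
  assumes t: "t \<in> carrier_mat n b" and F: "\<And>k l. k < J \<Longrightarrow> l < J \<Longrightarrow> F k l \<in> carrier_mat a n"
  shows "big_mat a n J F * tensor_id J t = big_mat a b J (\<lambda>k l. F k l * t)"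
proof (rule eq_matI)
  fix r c assume "r < dim_row (big_mat a b J (\<lambda>k l. F k l * t))" "c < dim_col (big_mat a b J (\<lambda>k l. F k l * t))"
  then have r: "r < a * J" and c: "c < b * J" by auto
  note rc = div_mod_less[OF r] div_mod_less[OF c]
  have T: "tensor_id J t \<in> carrier_mat (n * J) (b * J)" using t by (auto simp: tensor_id_def)
  have "(big_mat a n J F * tensor_id J t) $$ (r, c)
      = (\<Sum>q<n * J. big_mat a n J F $$ (r, q) * tensor_id J t $$ (q, c))"
    using T r c by (intro index_mult_sum[of _ "a * J" "n * J" _ "b * J"]) auto
  also have "\<dots> = (\<Sum>q<n * J. (\<lambda>i k. F (r mod J) k $$ (r div J, i) * (if k = c mod J then t $$ (i, c div J) else 0)) (q div J) (q mod J))"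
    using t r c rc by (intro sum.cong refl) (auto simp: tensor_id_def big_mat_index div_mod_less)
  also have "\<dots> = (\<Sum>i<n. \<Sum>k<J. F (r mod J) k $$ (r div J, i) * (if k = c mod J then t $$ (i, c div J) else 0))"
    by (rule sum_div_mod)
  also have "\<dots> = (\<Sum>i<n. F (r mod J) (c mod J) $$ (r div J, i) * t $$ (i, c div J))"
    using rc by (simp add: if_distrib[of "\<lambda>x. _ * x"] sum.delta cong: if_cong)
  also have "\<dots> = (F (r mod J) (c mod J) * t) $$ (r div J, c div J)"
    using rc by (intro index_mult_sum[symmetric, OF F t]) auto
  finally show "(big_mat a n J F * tensor_id J t) $$ (r, c) = big_mat a b J (\<lambda>k l. F k l * t) $$ (r, c)"
    using r c by (simp add: big_mat_index)
qed (use t in \<open>auto simp: tensor_id_def\<close>)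

lemma isometry_tensor_id:
  assumes V: "isometry e m V"
  shows "isometry (e * J) (m * J) (tensor_id J V)"
proof -
  note V' = isometryD[OF V]
  have d: "dim_row V = m" "dim_col V = e" using V' by auto
  have adj: "mat_adjoint (tensor_id J V) = tensor_id J (mat_adjoint V)"
    by (rule eq_matI) (auto simp: tensor_id_def big_mat_index div_mod_less)
  have "mat_adjoint (tensor_id J V) * tensor_id J V
      = big_mat e e J (\<lambda>k l. mat_adjoint V * (if k = l then V else 0\<^sub>m m e))"
    unfolding adj unfolding tensor_id_def[of J V] d
    by (rule tensor_id_mult_big_mat) (use V' in auto)
  also have "\<dots> = 1\<^sub>m (e * J)"
  proof (rule eq_matI)
    fix r c assume "r < dim_row (1\<^sub>m (e * J) :: complex mat)" "c < dim_col (1\<^sub>m (e * J) :: complex mat)"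
    then have r: "r < e * J" and c: "c < e * J" by auto
    have "r = c \<longleftrightarrow> r mod J = c mod J \<and> r div J = c div J" by (metis div_mult_mod_eq)
    then show "big_mat e e J (\<lambda>k l. mat_adjoint V * (if k = l then V else 0\<^sub>m m e)) $$ (r, c) = 1\<^sub>m (e * J) $$ (r, c)"
      using r c V' div_mod_less[OF r] div_mod_less[OF c] by (auto simp: big_mat_index simp del: index_mult_mat(1))
  qed auto
  finally show ?thesis using d by (simp add: isometry_def) (simp add: tensor_id_def d)
qed

lemma nc_level_unique:
  "x \<in> nc_level n \<Longrightarrow> x \<in> nc_level m \<Longrightarrow> n = m"
  by (metis nc_levelD carrier_matD(1))

lemma basic_free_set_iff:
  "x \<in> nc_level n \<Longrightarrow> n \<ge> 1 \<Longrightarrow> x \<in> basic_free_set \<delta> \<longleftrightarrow> mat_opnorm (mat_poly_eval n \<delta> x) < 1"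
  unfolding basic_free_set_def mem_Collect_eq by (metis nc_level_unique)

lemma free_variety_iff:
  "x \<in> nc_level n \<Longrightarrow> n \<ge> 1 \<Longrightarrow> x \<in> free_variety A \<longleftrightarrow> (\<forall>p\<in>A. poly_eval n p x = 0\<^sub>m n n)"
  unfolding free_variety_def mem_Collect_eq by (metis nc_level_unique)

lemma basic_free_set_dsum:
  assumes x: "x \<in> nc_level n" "n \<ge> 1" and y: "y \<in> nc_level m" "m \<ge> 1" and d: "\<delta> \<in> carrier_mat J J" "J \<ge> 1"
  shows "nc_dsum x y \<in> basic_free_set \<delta> \<longleftrightarrow> x \<in> basic_free_set \<delta> \<and> y \<in> basic_free_set \<delta>"
  using basic_free_set_iff[OF nc_dsum_level[OF x(1) y(1)], of \<delta>] basic_free_set_iff[OF x, of \<delta>] basic_free_set_iff[OF y, of \<delta>]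
    mat_opnorm_dsum[OF mat_poly_eval_carrier[OF d(1), of n x] mat_poly_eval_carrier[OF d(1), of m y]] x(2)
  by (simp add: mat_poly_eval_dsum[OF x(1) y(1) d])

lemma free_variety_dsum:
  assumes x: "x \<in> nc_level n" "n \<ge> 1" and y: "y \<in> nc_level m" "m \<ge> 1"
  shows "nc_dsum x y \<in> free_variety A \<longleftrightarrow> x \<in> free_variety A \<and> y \<in> free_variety A"
proof -
  have 0: "0\<^sub>m (n + m) (n + m) = mat_dsum (0\<^sub>m n n) (0\<^sub>m m m)"
    by (rule eq_matI) (auto simp: mat_dsum_index[of _ n n _ m m])
  have "mat_dsum a b = mat_dsum (0\<^sub>m n n) (0\<^sub>m m m) \<longleftrightarrow> a = 0\<^sub>m n n \<and> b = 0\<^sub>m m m"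
    if "a \<in> carrier_mat n n" "b \<in> carrier_mat m m" for a b
    using mat_dsum_inj[OF _ that, of "0\<^sub>m n n" "0\<^sub>m m m"] by auto
  then show ?thesis
    using free_variety_iff[OF nc_dsum_level[OF x(1) y(1)], of A] free_variety_iff[OF x, of A] free_variety_iff[OF y, of A] x(2)
    by (auto simp: poly_eval_dsum[OF x(1) y(1)] 0)
qed

text \<open>
  If \<open>z\<close> is a compression of \<open>y\<close> that respects polynomials, then \<open>\<delta>(z)\<close> is the compression of \<open>\<delta>(y)\<close>
  by the isometry \<open>V \<otimes> 1\<close>, so its norm is not larger.
\<close>

lemma basic_free_set_compress:
  assumes V: "isometry e m V" and e: "e \<ge> 1" and y: "y \<in> nc_level m" "y \<in> basic_free_set \<delta>" and z: "z \<in> nc_level e"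
    and pz: "\<And>p. poly_eval e p z = mat_adjoint V * poly_eval m p y * V"
    and d: "\<delta> \<in> carrier_mat J J"
  shows "z \<in> basic_free_set \<delta>"
proof -
  let ?K = "tensor_id J V" and ?D = "mat_poly_eval m \<delta> y"
  note V' = isometryD[OF V]
  have dV: "dim_row V = m" "dim_col V = e" using V' by auto
  note K = isometry_tensor_id[OF V, of J]
  note K' = isometryD[OF K]
  have m: "m \<ge> 1" using isometry_dim_le[OF V] e by simp
  have D: "?D \<in> carrier_mat (m * J) (m * J)" using d by simp
  have adj: "mat_adjoint ?K = tensor_id J (mat_adjoint V)"
    by (rule eq_matI) (auto simp: tensor_id_def big_mat_index div_mod_less)
  have "mat_poly_eval e \<delta> z = mat_adjoint ?K * ?D * ?K"
    unfolding adj mat_poly_eval_big_mat[OF d]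
    by (subst tensor_id_mult_big_mat[OF V'(2)], simp, subst big_mat_mult_tensor_id[OF V'(1)])
       (use V' in \<open>auto simp: pz intro: mult_carrier_mat\<close>)
  also have "mat_opnorm \<dots> \<le> mat_opnorm ?D"
    unfolding mat_opnorm_le_iff[OF mat_opnorm_nonneg]
  proof
    fix v :: "complex vec" assume "v \<in> carrier_vec (dim_col (mat_adjoint ?K * ?D * ?K))"
    then have v: "v \<in> carrier_vec (e * J)" using K' by auto
    then have Kv: "?K *\<^sub>v v \<in> carrier_vec (m * J)" using K' by auto
    have "(mat_adjoint ?K * ?D * ?K) *\<^sub>v v = (mat_adjoint ?K * ?D) *\<^sub>v (?K *\<^sub>v v)"
      using K' D v by (intro assoc_mult_mat_vec[of _ "e * J" "m * J"]) auto
    also have "\<dots> = mat_adjoint ?K *\<^sub>v (?D *\<^sub>v (?K *\<^sub>v v))"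
      using K' D Kv by (intro assoc_mult_mat_vec[of _ "e * J" "m * J"]) auto
    also have "sqn \<dots> \<le> sqn (?D *\<^sub>v (?K *\<^sub>v v))"
      using D by (intro isometry_adjoint_sqn[OF K]) auto
    also have "\<dots> \<le> (mat_opnorm ?D)\<^sup>2 * sqn (?K *\<^sub>v v)"
      using D Kv by (intro sqn_mult_le_opnorm) auto
    also have "sqn (?K *\<^sub>v v) = sqn v" by (rule isometry_sqn[OF K v])
    finally show "sqn ((mat_adjoint ?K * ?D * ?K) *\<^sub>v v) \<le> (mat_opnorm ?D)\<^sup>2 * sqn v" .
  qed
  finally show ?thesis
    using basic_free_set_iff[OF z e, of \<delta>] basic_free_set_iff[OF y(1) m, of \<delta>] y(2) by simp
qed

section \<open>Intertwining relations\<close>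

text \<open>
  The relation \<open>y T = T z\<close> says that \<open>y \<oplus> z\<close> commutes with the shear with upper right corner \<open>T\<close>.
  Hence \<open>y \<oplus> z\<close> is similar to itself by this shear, and \<open>f(y) \<oplus> f(z)\<close> commutes with it as well; the upper
  right corner of that equation is the conclusion.
\<close>

lemma intertwining:
  assumes nc: "nc_function_on W f"
    and y: "y \<in> W" "y \<in> nc_level m" and z: "z \<in> W" "z \<in> nc_level e" and yz: "nc_dsum y z \<in> W"
    and pos: "m \<ge> 1" "e \<ge> 1"
    and T: "T \<in> carrier_mat m e" and comm: "\<And>i. y i * T = T * z i"
  shows "f y * T = T * f z"
proof -
  define s where "s = four_block_mat (1\<^sub>m m) T (0\<^sub>m e m) (1\<^sub>m e)"
  define t where "t = four_block_mat (1\<^sub>m m) (- T) (0\<^sub>m e m) (1\<^sub>m e)"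
  have s: "s \<in> carrier_mat (m + e) (m + e)" and t: "t \<in> carrier_mat (m + e) (m + e)"
    unfolding s_def t_def using T by (auto intro!: four_block_carrier_mat)
  have one: "1\<^sub>m (m + e) = four_block_mat (1\<^sub>m m) (0\<^sub>m m e) (0\<^sub>m e m) (1\<^sub>m e :: complex mat)"
    by (rule eq_matI) auto
  have TT: "T + - T = 0\<^sub>m m e" "- T + T = 0\<^sub>m m e" "- 0\<^sub>m e e + 1\<^sub>m e = (1\<^sub>m e :: complex mat)"
    using T by (auto intro!: eq_matI)
  have st: "s * t = 1\<^sub>m (m + e)" unfolding s_def t_def one using T
    by (subst mult_four_block_mat[of _ m m _ e _ e _ _ m _ e]) (auto simp: TT intro!: cong_four_block_mat)
  have ts: "t * s = 1\<^sub>m (m + e)" unfolding s_def t_def one using T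
    by (subst mult_four_block_mat[of _ m m _ e _ e _ _ m _ e]) (auto simp: TT intro!: cong_four_block_mat)
  have Xs: "mat_dsum a b * s = four_block_mat a (a * T) (0\<^sub>m e m) b"
    and sX: "s * mat_dsum a b = four_block_mat a (T * b) (0\<^sub>m e m) b"
    if "a \<in> carrier_mat m m" "b \<in> carrier_mat e e" for a b
    unfolding s_def mat_dsum_def using T that
    by (subst mult_four_block_mat[of _ m m _ e _ e _ _ m _ e]; auto intro!: cong_four_block_mat)+
  have conj: "t * X * s = X \<longleftrightarrow> X * s = s * X" if X: "X \<in> carrier_mat (m + e) (m + e)" for X
  proof
    assume *: "t * X * s = X"
    have "s * (t * X * s) = s * (t * (X * s))" using s t X by (simp add: assoc_mult_mat[of t "m+e" "m+e" X "m+e"])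
    also have "\<dots> = X * s"
      using s t X st by (subst assoc_mult_mat[symmetric, of _ "m + e" "m + e" _ "m + e" _ "m + e"]) auto
    finally show "X * s = s * X" using * by simp
  next
    assume *: "X * s = s * X"
    have "t * X * s = t * (s * X)" using s t X * by (subst assoc_mult_mat[of _ "m + e" "m + e" _ "m + e" _ "m + e"]) auto
    also have "\<dots> = X" using s t X ts by (subst assoc_mult_mat[symmetric, of _ "m + e" "m + e" _ "m + e" _ "m + e"]) auto
    finally show "t * X * s = X" .
  qed
  have fix_pt: "(\<lambda>i. t * nc_dsum y z i * s) = nc_dsum y z"
  proof
    fix i
    have "nc_dsum y z i * s = s * nc_dsum y z i"
      unfolding nc_dsum_def by (simp add: Xs sX nc_levelD[OF y(2)] nc_levelD[OF z(2)] comm)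
    then show "t * nc_dsum y z i * s = nc_dsum y z i"
      using conj nc_levelD[OF nc_dsum_level[OF y(2) z(2)]] by blast
  qed
  have fy: "f y \<in> carrier_mat m m" and fz: "f z \<in> carrier_mat e e"
    using nc y z pos by (auto simp: nc_function_on_def graded_on_def)
  have fyz: "f (nc_dsum y z) = mat_dsum (f y) (f z)"
    using nc y z yz by (auto simp: nc_function_on_def)
  have inv: "inverts_mat s t \<and> inverts_mat t s" using s t st ts by (simp add: inverts_mat_def)
  have yzl: "nc_dsum y z \<in> W \<inter> nc_level (m + e)" using yz nc_dsum_level[OF y(2) z(2)] by blast
  have "f (\<lambda>i. t * nc_dsum y z i * s) = t * f (nc_dsum y z) * s"
  proof -
    have "\<forall>n\<ge>1. \<forall>s\<in>carrier_mat n n. \<forall>t\<in>carrier_mat n n. \<forall>x.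
          inverts_mat s t \<and> inverts_mat t s \<and> x \<in> W \<inter> nc_level n \<and> (\<lambda>i. t * x i * s) \<in> W \<inter> nc_level n
          \<longrightarrow> f (\<lambda>i. t * x i * s) = t * f x * s"
      using nc by (simp add: nc_function_on_def)
    from this[rule_format, of "m + e" s t "nc_dsum y z"] show ?thesis
      using pos s t inv yzl unfolding fix_pt by auto
  qed
  then have "t * mat_dsum (f y) (f z) * s = mat_dsum (f y) (f z)" unfolding fix_pt fyz by simp
  then have eq: "four_block_mat (f y) (f y * T) (0\<^sub>m e m) (f z) = four_block_mat (f y) (T * f z) (0\<^sub>m e m) (f z)"
    unfolding conj[OF mat_dsum_carrier[OF fy fz]] using Xs[OF fy fz] sX[OF fy fz] by simp
  show ?thesis
  proof (rule eq_matI)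
    fix i j assume "i < dim_row (T * f z)" "j < dim_col (T * f z)"
    then have "i < m" "j < e" using T fz by auto
    then show "(f y * T) $$ (i, j) = (T * f z) $$ (i, j)"
      using arg_cong[OF eq, of "\<lambda>M. M $$ (i, m + j)"] fy fz T by auto
  qed (use T fy fz in auto)
qed

lemma eq_mat_by_vec:
  assumes "A \<in> carrier_mat m e" "B \<in> carrier_mat m e"
    and eq: "\<And>u. u \<in> carrier_vec e \<Longrightarrow> A *\<^sub>v u = B *\<^sub>v u"
  shows "A = (B :: complex mat)"
proof (rule eq_matI)
  fix i j assume "i < dim_row B" "j < dim_col B"
  then show "A $$ (i, j) = B $$ (i, j)"
    using arg_cong[OF eq[of "unit_vec e j"], of "\<lambda>v. v $ i"] assms(1,2) by auto
qed (use assms in auto)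

section \<open>Direct sums of finitely many points\<close>

text \<open>
  The size of the matrices in a point. It can be read off from any coordinate, and making it a
  function of the point turns evaluation of a polynomial into a graded function.
\<close>

definition lvl :: "'d nc_point \<Rightarrow> nat" where
  "lvl x = dim_row (x undefined)"

lemma lvl_eq: "x \<in> nc_level n \<Longrightarrow> lvl x = n"
  using nc_levelD[of x n undefined] by (simp add: lvl_def)

abbreviation peval :: "'d free_poly \<Rightarrow> 'd nc_point \<Rightarrow> complex mat" where
  "peval p x \<equiv> poly_eval (lvl x) p x"

text \<open>
  The condition on direct sums alone, which can be used for \<open>f\<close>, for the evaluation of a polynomial and
  for their difference alike.
\<close>

definition dsum_additive :: "'d nc_point set \<Rightarrow> ('d nc_point \<Rightarrow> complex mat) \<Rightarrow> bool" where
  "dsum_additive D \<phi> \<longleftrightarrow> (\<forall>x\<in>D. \<phi> x \<in> carrier_mat (lvl x) (lvl x))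
     \<and> (\<forall>x\<in>D. \<forall>y\<in>D. \<phi> (nc_dsum x y) = mat_dsum (\<phi> x) (\<phi> y))"

definition nc_set :: "'d nc_point set \<Rightarrow> bool" where
  "nc_set D \<longleftrightarrow> (\<forall>x\<in>D. lvl x \<ge> 1 \<and> x \<in> nc_level (lvl x)) \<and> (\<forall>x\<in>D. \<forall>y\<in>D. nc_dsum x y \<in> D)"

lemma nc_setD:
  assumes "nc_set D" "x \<in> D"
  shows "lvl x \<ge> 1" "x \<in> nc_level (lvl x)" "y \<in> D \<Longrightarrow> nc_dsum x y \<in> D" "y \<in> D \<Longrightarrow> lvl (nc_dsum x y) = lvl x + lvl y"
  using assms nc_dsum_level lvl_eq by (auto simp: nc_set_def) blast

lemma dsum_additive_peval: "nc_set D \<Longrightarrow> dsum_additive D (peval p)"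
  by (auto simp: dsum_additive_def nc_setD poly_eval_dsum)

lemma dsum_additive_diff:
  assumes D: "nc_set D" and f: "dsum_additive D f" and g: "dsum_additive D g"
  shows "dsum_additive D (\<lambda>x. f x - g x)"
  unfolding dsum_additive_def
proof (intro conjI ballI)
  fix x y assume x: "x \<in> D" and y: "y \<in> D"
  have "f x \<in> carrier_mat (lvl x) (lvl x)" "f y \<in> carrier_mat (lvl y) (lvl y)"
    "g x \<in> carrier_mat (lvl x) (lvl x)" "g y \<in> carrier_mat (lvl y) (lvl y)"
    using f g x y by (auto simp: dsum_additive_def)
  moreover from this have "f x - g x \<in> carrier_mat (lvl x) (lvl x)" "f y - g y \<in> carrier_mat (lvl y) (lvl y)"
    by auto
  ultimately have "mat_dsum (f x) (f y) - mat_dsum (g x) (g y) = mat_dsum (f x - g x) (f y - g y)"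
    by (intro eq_matI) (auto simp: mat_dsum_index[of _ "lvl x" "lvl x" _ "lvl y" "lvl y"])
  then show "f (nc_dsum x y) - g (nc_dsum x y) = mat_dsum (f x - g x) (f y - g y)"
    using f g x y by (auto simp: dsum_additive_def)
qed (use g in \<open>auto simp: dsum_additive_def intro!: minus_carrier_mat\<close>)

text \<open>
  The direct sum serves all functions at once: the same \<open>Y\<close> and \<open>\<Xi>\<close> work for \<open>f\<close>, for
  every polynomial and for their differences.
\<close>

lemma direct_sum_of_list:
  fixes xs :: "('d nc_point \<times> complex vec) list"
  assumes D: "nc_set D" and "xs \<noteq> []" and "\<And>x \<xi>. (x, \<xi>) \<in> set xs \<Longrightarrow> x \<in> D \<and> \<xi> \<in> carrier_vec (lvl x)"
  shows "\<exists>Y\<in>D. \<exists>\<Xi>\<in>carrier_vec (lvl Y). \<forall>\<phi>. dsum_additive D \<phi> \<longrightarrow>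
    sqn (\<phi> Y *\<^sub>v \<Xi>) = (\<Sum>(x, \<xi>)\<leftarrow>xs. sqn (\<phi> x *\<^sub>v \<xi>))"
  using assms(2,3)
proof (induction xs rule: list_nonempty_induct)
  case (single a)
  then show ?case by (cases a) auto
next
  case (cons a xs)
  obtain x \<xi> where a: "a = (x, \<xi>)" by (cases a)
  have x: "x \<in> D" "\<xi> \<in> carrier_vec (lvl x)" using cons.prems a by auto
  obtain Y \<Xi> where Y: "Y \<in> D" "\<Xi> \<in> carrier_vec (lvl Y)"
    and eq: "\<And>\<phi>. dsum_additive D \<phi> \<Longrightarrow> sqn (\<phi> Y *\<^sub>v \<Xi>) = (\<Sum>(x, \<xi>)\<leftarrow>xs. sqn (\<phi> x *\<^sub>v \<xi>))"
    using cons.IH cons.prems by (metis list.set_intros(2))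
  show ?case
  proof (intro bexI[of _ "nc_dsum x Y"] bexI[of _ "\<xi> @\<^sub>v \<Xi>"] allI impI)
    fix \<phi> assume \<phi>: "dsum_additive D \<phi>"
    have "\<phi> (nc_dsum x Y) *\<^sub>v (\<xi> @\<^sub>v \<Xi>) = (\<phi> x *\<^sub>v \<xi>) @\<^sub>v (\<phi> Y *\<^sub>v \<Xi>)"
      using \<phi> x Y mat_dsum_mult_vec[of "\<phi> x" "lvl x" "lvl x" "\<phi> Y" "lvl Y" "lvl Y" \<xi> \<Xi>]
      by (simp add: dsum_additive_def)
    then show "sqn (\<phi> (nc_dsum x Y) *\<^sub>v (\<xi> @\<^sub>v \<Xi>)) = (\<Sum>(x, \<xi>)\<leftarrow>a # xs. sqn (\<phi> x *\<^sub>v \<xi>))"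
      using eq[OF \<phi>] by (simp add: a sqn_append)
  qed (use x Y nc_setD[OF D] in auto)
qed

lemma direct_sum_of_points:
  assumes D: "nc_set D" and "finite F" "F \<noteq> {}" "F \<subseteq> D"
  shows "\<exists>Y\<in>D. \<forall>\<phi> \<psi>. dsum_additive D \<phi> \<longrightarrow> dsum_additive D \<psi> \<longrightarrow> \<phi> Y = \<psi> Y \<longrightarrow> (\<forall>x\<in>F. \<phi> x = \<psi> x)"
  using assms(2-4)
proof (induction F rule: finite_ne_induct)
  case (insert x F)
  then obtain Y where Y: "Y \<in> D"
    and eq: "\<And>\<phi> \<psi> x. dsum_additive D \<phi> \<Longrightarrow> dsum_additive D \<psi> \<Longrightarrow> \<phi> Y = \<psi> Y \<Longrightarrow> x \<in> F \<Longrightarrow> \<phi> x = \<psi> x"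
    by (metis insert_subset)
  have x: "x \<in> D" using insert.prems by simp
  have "\<phi> x = \<psi> x \<and> \<phi> Y = \<psi> Y"
    if "dsum_additive D \<phi>" "dsum_additive D \<psi>" "\<phi> (nc_dsum x Y) = \<psi> (nc_dsum x Y)" for \<phi> \<psi>
    using that x Y mat_dsum_inj[of "\<phi> x" "\<phi> Y" "\<psi> x" "\<psi> Y" "lvl x" "lvl x" "lvl Y" "lvl Y"]
    by (auto simp: dsum_additive_def)
  then show ?case using eq nc_setD(3)[OF D x Y] by (intro bexI[of _ "nc_dsum x Y"]) blast+
qed auto

section \<open>Cyclic subspaces\<close>

lemma peval_mult_vec_add:
  "v \<in> carrier_vec n \<Longrightarrow> poly_eval n (p + q) x *\<^sub>v v = poly_eval n p x *\<^sub>v v + poly_eval n q x *\<^sub>v v"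
  by (simp add: poly_eval_add add_mult_distrib_mat_vec[of _ n n])

lemma poly_eval_scale:
  "x \<in> nc_level n \<Longrightarrow> poly_eval n (Poly_Mapping.single 0 c * p) x = c \<cdot>\<^sub>m poly_eval n p x"
  by (simp add: poly_eval_mult poly_eval_monom mult_smult_assoc_mat[of _ n n _ n])

lemma poly_eval_scale_vec:
  "x \<in> nc_level n \<Longrightarrow> v \<in> carrier_vec n \<Longrightarrow>
    poly_eval n (Poly_Mapping.single 0 c * p) x *\<^sub>v v = c \<cdot>\<^sub>v (poly_eval n p x *\<^sub>v v)"
  by (simp add: poly_eval_scale) (intro eq_vecI; auto)

lemma poly_eval_mult_vec:
  "x \<in> nc_level n \<Longrightarrow> v \<in> carrier_vec n \<Longrightarrow>
    poly_eval n (p * q) x *\<^sub>v v = poly_eval n p x *\<^sub>v (poly_eval n q x *\<^sub>v v)"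
  by (simp add: poly_eval_mult assoc_mult_mat_vec[of _ n n _ n])

lemma poly_eval_var:
  "x \<in> nc_level n \<Longrightarrow> poly_eval n (Poly_Mapping.single (Nc_Word [i]) 1) x = x i"
  using nc_levelD[of x n i]
  by (subst poly_eval_monom) (auto simp: word_eval_def intro!: eq_matI)

text \<open>
  For \<open>I\<close> the whole algebra this is the cyclic subspace of \<open>v\<close>; for a left ideal it is an
  invariant subspace of it.
\<close>

lemma subspace_orbit:
  assumes x: "x \<in> nc_level n" and v: "v \<in> carrier_vec n"
    and I: "0 \<in> I" "\<And>p q. p \<in> I \<Longrightarrow> q \<in> I \<Longrightarrow> p + q \<in> I" "\<And>p q. q \<in> I \<Longrightarrow> p * q \<in> I"
  shows "subspace_vec n ((\<lambda>p. poly_eval n p x *\<^sub>v v) ` I)"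
  unfolding subspace_vec_def
proof (intro conjI ballI allI)
  have "poly_eval n 0 x *\<^sub>v v = 0\<^sub>v n"
    using v by (intro eq_vecI) (auto simp: poly_eval_index scalar_prod_def)
  then show "0\<^sub>v n \<in> (\<lambda>p. poly_eval n p x *\<^sub>v v) ` I" using I(1) by (metis image_eqI)
  fix u assume "u \<in> (\<lambda>p. poly_eval n p x *\<^sub>v v) ` I"
  then obtain p where p: "p \<in> I" "u = poly_eval n p x *\<^sub>v v" by auto
  { fix w assume "w \<in> (\<lambda>p. poly_eval n p x *\<^sub>v v) ` I"
    then obtain q where q: "q \<in> I" "w = poly_eval n q x *\<^sub>v v" by auto
    show "u + w \<in> (\<lambda>p. poly_eval n p x *\<^sub>v v) ` I"
      using I(2)[OF p(1) q(1)] p q v by (auto simp: peval_mult_vec_add intro!: image_eqI[of _ _ "p + q"]) }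
  fix c
  show "c \<cdot>\<^sub>v u \<in> (\<lambda>p. poly_eval n p x *\<^sub>v v) ` I"
    using I(3)[OF p(1), of "Poly_Mapping.single 0 c"] p v x
    by (auto simp: poly_eval_scale_vec intro!: image_eqI[of _ _ "Poly_Mapping.single 0 c * p"])
qed auto

section \<open>Values of nc functions are polynomials\<close>

lemma nc_set_basic_free_set:
  assumes d: "\<delta> \<in> carrier_mat J J" "J \<ge> 1"
  shows "nc_set (basic_free_set \<delta>)"
proof -
  have *: "lvl x \<ge> 1 \<and> x \<in> nc_level (lvl x)" if "x \<in> basic_free_set \<delta>" for x
    using that lvl_eq by (fastforce simp: basic_free_set_def)
  then have "nc_dsum x y \<in> basic_free_set \<delta>" if "x \<in> basic_free_set \<delta>" "y \<in> basic_free_set \<delta>" for x y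
    using basic_free_set_dsum[OF _ _ _ _ d, of x "lvl x" y "lvl y"] that by simp
  with * show ?thesis by (simp add: nc_set_def)
qed

lemma nc_set_variety_inter:
  assumes d: "\<delta> \<in> carrier_mat J J" "J \<ge> 1"
  shows "nc_set (free_variety A \<inter> basic_free_set \<delta>)"
proof -
  note G = nc_set_basic_free_set[OF d]
  have "nc_dsum x y \<in> free_variety A" 
    if "x \<in> free_variety A \<inter> basic_free_set \<delta>" "y \<in> free_variety A \<inter> basic_free_set \<delta>" for x y
    using free_variety_dsum[of x "lvl x" y "lvl y" A] nc_setD[OF G] that by simp
  with G show ?thesis by (simp add: nc_set_def)
qed

lemma nc_function_dsum_additive:
  assumes D: "nc_set D" and f: "nc_function_on D f"
  shows "dsum_additive D f"
  unfolding dsum_additive_def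
proof (intro conjI ballI)
  fix x assume x: "x \<in> D"
  have "graded_on D f" using f by (simp add: nc_function_on_def)
  then show "f x \<in> carrier_mat (lvl x) (lvl x)"
    unfolding graded_on_def using x nc_setD(1,2)[OF D x] by blast
  fix y assume y: "y \<in> D"
  show "f (nc_dsum x y) = mat_dsum (f x) (f y)"
    using f x y nc_setD(3)[OF D x y] by (simp add: nc_function_on_def)
qed

text \<open>
  Membership of a compression in \<open>V \<inter> G\<^sub>\<delta>\<close>: the norm condition is inherited from \<open>y\<close>, while the
  equations are required only after compression. In this way points off the variety lead to points on it.
\<close>

lemma compression_mem:
  assumes d: "\<delta> \<in> carrier_mat J J" and V: "isometry e m V" and e: "e \<ge> 1"
    and y: "y \<in> nc_level m" "y \<in> basic_free_set \<delta>" and z: "z \<in> nc_level e"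
    and wz: "\<And>w. word_eval e w z = mat_adjoint V * word_eval m w y * V"
    and vanish: "\<And>p. p \<in> A \<Longrightarrow> mat_adjoint V * poly_eval m p y * V = 0\<^sub>m e e"
  shows "z \<in> free_variety A \<inter> basic_free_set \<delta>" "poly_eval e p z = mat_adjoint V * poly_eval m p y * V"
proof -
  note V' = isometryD[OF V]
  have one: "1\<^sub>m e * a * 1\<^sub>m e = a" if "a \<in> carrier_mat e e" for a :: "complex mat"
    using that by simp
  have pz: "poly_eval e p z = mat_adjoint V * poly_eval m p y * V" for p
  proof -
    have "1\<^sub>m e * poly_eval e p z * 1\<^sub>m e = mat_adjoint V * poly_eval m p y * V"
      by (rule poly_eval_sandwich_eq[OF one_carrier_mat one_carrier_mat V'(2,1) z y(1)])
         (subst one[OF word_eval_carrier[OF z]], rule wz)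
    then show ?thesis by (simp only: one[OF poly_eval_carrier(1)])
  qed
  then show "poly_eval e p z = mat_adjoint V * poly_eval m p y * V" .
  show "z \<in> free_variety A \<inter> basic_free_set \<delta>"
    using basic_free_set_compress[OF V e y z pz d] free_variety_iff[OF z e, of A] vanish pz by simp
qed

lemma mult_vec_empty: "V \<in> carrier_mat m 0 \<Longrightarrow> u \<in> carrier_vec 0 \<Longrightarrow> V *\<^sub>v u = (0\<^sub>v m :: complex vec)"
  by (intro eq_vecI) (auto simp: scalar_prod_def)

text \<open>
  Restricting \<open>y\<close> to the invariant subspace \<open>L\<close> gives a point \<open>z\<close> of \<open>V \<inter> G\<^sub>\<delta>\<close> with \<open>y V = V z\<close>. Then
  \<open>f(y) V = V f(z)\<close> by the intertwining property, so the range \<open>L\<close> of \<open>V\<close> is invariant under \<open>f(y)\<close>.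
\<close>

lemma invariant_subspace:
  fixes f :: "'d nc_point \<Rightarrow> complex mat"
  assumes d: "\<delta> \<in> carrier_mat J J" "J \<ge> 1"
    and f: "nc_function_on (free_variety A \<inter> basic_free_set \<delta>) f"
    and y: "y \<in> free_variety A \<inter> basic_free_set \<delta>"
    and L: "subspace_vec (lvl y) L" and inv: "\<And>i v. v \<in> L \<Longrightarrow> y i *\<^sub>v v \<in> L"
    and v: "v \<in> L"
  shows "f y *\<^sub>v v \<in> L"
proof -
  let ?W = "free_variety A \<inter> basic_free_set \<delta>"
  define m where "m = lvl y"
  note W = nc_set_variety_inter[OF d, of A]
  have m: "m \<ge> 1" and ym: "y \<in> nc_level m" using nc_setD[OF W y] by (auto simp: m_def)
  have L: "subspace_vec m L" using L by (simp add: m_def)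
  have fy: "f y \<in> carrier_mat m m"
    using nc_function_dsum_additive[OF W f] y by (auto simp: dsum_additive_def m_def)
  obtain e V where V: "isometry e m V" and VL: "\<And>u. u \<in> carrier_vec e \<Longrightarrow> V *\<^sub>v u \<in> L"
    and VV: "\<And>v. v \<in> L \<Longrightarrow> V *\<^sub>v (mat_adjoint V *\<^sub>v v) = v"
    using isometry_onto_subspace[OF L] by metis
  note V' = isometryD[OF V]
  show ?thesis
  proof (cases "e = 0")
    case True
    then have "v = 0\<^sub>v m" using VV[OF v] mult_vec_empty[of V m "mat_adjoint V *\<^sub>v v"] V' by simp
    moreover have "f y *\<^sub>v 0\<^sub>v m = 0\<^sub>v m" using fy by (intro eq_vecI) auto
    ultimately show ?thesis using subspace_vecD(2)[OF L] by simp
  next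
    case False
    then have e: "e \<ge> 1" by simp
    define z where "z i = mat_adjoint V * (y i * V)" for i
    have yi: "y i \<in> carrier_mat m m" for i using ym by (rule nc_levelD)
    have zi: "z i \<in> carrier_mat e e" for i using V' yi[of i] by (auto simp: z_def)
    have z: "z \<in> nc_level e" using zi by (simp add: nc_level_def)
    have yV: "y i * V = V * z i" for i
    proof (rule eq_mat_by_vec[of _ m e])
      fix u :: "complex vec" assume u: "u \<in> carrier_vec e"
      define l where "l = y i *\<^sub>v (V *\<^sub>v u)"
      have l: "l \<in> L" unfolding l_def using VL[OF u] inv by blast
      have 1: "(y i * V) *\<^sub>v u = l" unfolding l_def using assoc_mult_mat_vec[OF yi V'(1) u] .
      have "(V * z i) *\<^sub>v u = V *\<^sub>v (z i *\<^sub>v u)" using assoc_mult_mat_vec[OF V'(1) zi u] .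
      also have "z i *\<^sub>v u = mat_adjoint V *\<^sub>v l"
        unfolding z_def using assoc_mult_mat_vec[OF V'(2) mult_carrier_mat[OF yi V'(1)] u] 1 by simp
      finally show "(y i * V) *\<^sub>v u = (V * z i) *\<^sub>v u" using 1 VV[OF l] by simp
    qed (rule mult_carrier_mat[OF yi V'(1)], rule mult_carrier_mat[OF V'(1) zi])
    have wV: "word_eval m (Nc_Word us) y * V = V * word_eval e (Nc_Word us) z" for us
    proof (induction us)
      case Nil
      then show ?case using V' by simp
    next
      case (Cons i us)
      let ?y = "word_eval m (Nc_Word us) y" and ?z = "word_eval e (Nc_Word us) z"
      have "y i * ?y * V = y i * (?y * V)"
        using assoc_mult_mat[OF yi word_eval_carrier[OF ym] V'(1)] .
      also have "\<dots> = y i * V * ?z"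
        unfolding Cons using assoc_mult_mat[OF yi V'(1) word_eval_carrier[OF z]] by simp
      also have "\<dots> = V * (z i * ?z)"
        unfolding yV using assoc_mult_mat[OF V'(1) zi word_eval_carrier[OF z]] by simp
      finally show ?case by (simp add: word_eval_Cons)
    qed
    have wz: "word_eval e w z = mat_adjoint V * word_eval m w y * V" for w
    proof (cases w)
      case (Nc_Word us)
      have "mat_adjoint V * word_eval m w y * V = mat_adjoint V * (word_eval m w y * V)"
        by (rule assoc_mult_mat[OF V'(2) word_eval_carrier[OF ym] V'(1)])
      also have "\<dots> = mat_adjoint V * V * word_eval e w z"
        unfolding Nc_Word wV using assoc_mult_mat[OF V'(2,1) word_eval_carrier[OF z]] by simp
      also have "\<dots> = word_eval e w z" unfolding V'(3) using left_mult_one_mat[OF word_eval_carrier[OF z]] .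
      finally show ?thesis ..
    qed
    have y': "y \<in> basic_free_set \<delta>" "\<And>p. p \<in> A \<Longrightarrow> poly_eval m p y = 0\<^sub>m m m"
      using y free_variety_iff[OF ym m, of A] by auto
    have zW: "z \<in> ?W"
      by (rule compression_mem(1)[OF d(1) V e ym y'(1) z wz]) (use y'(2) V' in auto)
    have "f y * V = V * f z"
      using intertwining[OF f y ym zW z nc_setD(3)[OF W y zW] m e V'(1)] yV by blast
    then have "f y *\<^sub>v v = V *\<^sub>v (f z *\<^sub>v (mat_adjoint V *\<^sub>v v))"
    proof -
      have fz: "f z \<in> carrier_mat e e"
        using nc_function_dsum_additive[OF W f] zW lvl_eq[OF z] by (auto simp: dsum_additive_def)
      have av: "mat_adjoint V *\<^sub>v v \<in> carrier_vec e" using V' by auto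
      have "f y *\<^sub>v v = f y *\<^sub>v (V *\<^sub>v (mat_adjoint V *\<^sub>v v))" using VV[OF v] by simp
      also have "\<dots> = (f y * V) *\<^sub>v (mat_adjoint V *\<^sub>v v)" using assoc_mult_mat_vec[OF fy V'(1) av] by simp
      also have "\<dots> = V *\<^sub>v (f z *\<^sub>v (mat_adjoint V *\<^sub>v v))"
        unfolding \<open>f y * V = V * f z\<close> using assoc_mult_mat_vec[OF V'(1) fz av] .
      finally show ?thesis .
    qed
    moreover have "f z *\<^sub>v (mat_adjoint V *\<^sub>v v) \<in> carrier_vec e"
      using nc_function_dsum_additive[OF W f] zW lvl_eq[OF z] by (auto simp: dsum_additive_def)
    ultimately show ?thesis using VL by simp
  qed
qed

text \<open>
  Let \<open>Y\<close> be the direct sum of \<open>n\<close> copies of \<open>x\<close> and \<open>\<Xi>\<close> the direct sum of the standard basis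
  vectors. The cyclic subspace of \<open>\<Xi>\<close> is invariant under \<open>Y\<close>, hence under \<open>f(Y)\<close>, so \<open>f(Y)\<Xi> = p(Y)\<Xi>\<close> for
  some \<open>p\<close>. In the summands this says that \<open>f(x)\<close> and \<open>p(x)\<close> agree on every basis vector.
\<close>

lemma nc_function_value_is_polynomial:
  fixes f :: "'d nc_point \<Rightarrow> complex mat"
  assumes d: "\<delta> \<in> carrier_mat J J" "J \<ge> 1"
    and f: "nc_function_on (free_variety A \<inter> basic_free_set \<delta>) f"
    and x: "x \<in> free_variety A \<inter> basic_free_set \<delta>"
  obtains p where "peval p x = f x"
proof -
  let ?W = "free_variety A \<inter> basic_free_set \<delta>"
  note W = nc_set_variety_inter[OF d, of A]
  note fW = nc_function_dsum_additive[OF W f]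
  define n where "n = lvl x"
  have n: "n \<ge> 1" using nc_setD[OF W x] by (simp add: n_def)
  define xs where "xs = map (\<lambda>j. (x, unit_vec n j :: complex vec)) [0..<n]"
  have "xs \<noteq> []" using n by (simp add: xs_def)
  moreover have "y \<in> ?W \<and> \<xi> \<in> carrier_vec (lvl y)" if "(y, \<xi>) \<in> set xs" for y \<xi>
    using that x by (auto simp: xs_def n_def)
  ultimately obtain Y \<Xi> where Y: "Y \<in> ?W" "\<Xi> \<in> carrier_vec (lvl Y)"
    and eq: "\<And>\<phi>. dsum_additive ?W \<phi> \<Longrightarrow> sqn (\<phi> Y *\<^sub>v \<Xi>) = (\<Sum>(x, \<xi>)\<leftarrow>xs. sqn (\<phi> x *\<^sub>v \<xi>))"
    using direct_sum_of_list[OF W, of xs] by blast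
  note Yl = nc_setD(2)[OF W Y(1)]
  define L where "L = range (\<lambda>p. peval p Y *\<^sub>v \<Xi>)"
  have L: "subspace_vec (lvl Y) L"
    unfolding L_def by (rule subspace_orbit[OF Yl Y(2)]) auto
  have "Y i *\<^sub>v v \<in> L" if v: "v \<in> L" for i v
  proof -
    obtain p where "v = peval p Y *\<^sub>v \<Xi>" using v by (auto simp: L_def)
    then have "Y i *\<^sub>v v = peval (Poly_Mapping.single (Nc_Word [i]) 1 * p) Y *\<^sub>v \<Xi>"
      using poly_eval_mult_vec[OF Yl Y(2)] poly_eval_var[OF Yl] by simp
    then show ?thesis by (auto simp: L_def)
  qed
  moreover have "\<Xi> \<in> L"
    using Y(2) poly_eval_one[OF Yl] unfolding L_def by (intro image_eqI[of _ _ 1]) auto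
  ultimately have "f Y *\<^sub>v \<Xi> \<in> L" by (intro invariant_subspace[OF d f Y(1) L])
  then obtain p where p: "f Y *\<^sub>v \<Xi> = peval p Y *\<^sub>v \<Xi>" by (auto simp: L_def)
  let ?g = "\<lambda>x. f x - peval p x"
  have g: "dsum_additive ?W ?g" by (rule dsum_additive_diff[OF W fW dsum_additive_peval[OF W]])
  have fY: "f Y \<in> carrier_mat (lvl Y) (lvl Y)" using fW Y by (simp add: dsum_additive_def)
  have "?g Y *\<^sub>v \<Xi> = f Y *\<^sub>v \<Xi> - peval p Y *\<^sub>v \<Xi>"
    using fY Y(2) by (intro minus_mult_distrib_mat_vec[of _ "lvl Y" "lvl Y"]) auto
  then have "?g Y *\<^sub>v \<Xi> = 0\<^sub>v (lvl Y)" unfolding p by auto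
  then have "(\<Sum>(x, \<xi>)\<leftarrow>xs. sqn (?g x *\<^sub>v \<xi>)) = 0" using eq[OF g] by simp
  then have "(\<Sum>j\<leftarrow>[0..<n]. sqn (?g x *\<^sub>v unit_vec n j)) = 0"
    by (simp add: xs_def comp_def)
  then have "(\<Sum>j<n. sqn (?g x *\<^sub>v unit_vec n j)) = 0"
    by (simp add: sum_list_distinct_conv_sum_set lessThan_atLeast0)
  then have 0: "sqn (?g x *\<^sub>v unit_vec n j) = 0" if "j < n" for j
    using that by (subst (asm) sum_nonneg_eq_0_iff) auto
  have fx: "f x \<in> carrier_mat n n" using fW x by (simp add: dsum_additive_def n_def)
  have gx: "?g x \<in> carrier_mat n n" by (auto simp: n_def)
  have "peval p x = f x"
  proof (rule eq_matI)
    fix i j assume "i < dim_row (f x)" "j < dim_col (f x)"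
    then have ij: "i < n" "j < n" using fx by auto
    have "?g x *\<^sub>v unit_vec n j = 0\<^sub>v n" using 0[OF ij(2)] gx sqn_eq_0[of "?g x *\<^sub>v unit_vec n j" n] by auto
    then have "(?g x *\<^sub>v unit_vec n j) $ i = 0" using ij by simp
    then show "peval p x $$ (i, j) = f x $$ (i, j)" using ij gx fx by (auto simp: n_def)
  qed (use fx in \<open>auto simp: n_def\<close>)
  then show ?thesis by (rule that)
qed

section \<open>Interpolation at one vector\<close>

text \<open>
  This is the step that produces the norm bound. Let \<open>M\<close> be the cyclic subspace of \<open>\<xi>\<close> under \<open>y\<close> and
  \<open>N\<close> its subspace of all \<open>p(y)\<xi>\<close> with \<open>p(x) = 0\<close>. Both are invariant, so compressing \<open>y\<close> to the orthogonal
  complement of \<open>N\<close> in \<open>M\<close> gives a point \<open>z\<close> for which \<open>p(z)\<close> is the compression of \<open>p(y)\<close>, for every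
  polynomial \<open>p\<close>. If \<open>p(x) = 0\<close> then \<open>p(y)\<close> maps \<open>M\<close> into \<open>N\<close> and so \<open>p(z) = 0\<close>; as \<open>x\<close> lies on the variety,
  so does \<open>z\<close>. Thus \<open>f(z)\<close> is defined and has norm at most \<open>B\<close>.

  Since \<open>z \<oplus> x\<close> is in \<open>V \<inter> G\<^sub>\<delta>\<close>, one polynomial \<open>p\<close> has the values \<open>f(z)\<close> at \<open>z\<close> and \<open>f(x)\<close> at \<open>x\<close>. The component
  of \<open>p(y)\<xi>\<close> orthogonal to \<open>N\<close> is \<open>f(z)\<close> applied to the one of \<open>\<xi>\<close>, and its component in \<open>N\<close> is removed by
  subtracting from \<open>p\<close> a polynomial that vanishes at \<open>x\<close>.
\<close>

lemma pointwise_interpolation: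
  fixes f :: "'d nc_point \<Rightarrow> complex mat"
  assumes d: "\<delta> \<in> carrier_mat J J" "J \<ge> 1"
    and f: "nc_function_on (free_variety A \<inter> basic_free_set \<delta>) f"
    and bound: "\<And>x. x \<in> free_variety A \<inter> basic_free_set \<delta> \<Longrightarrow> mat_opnorm (f x) \<le> B"
    and x: "x \<in> free_variety A \<inter> basic_free_set \<delta>"
    and y: "y \<in> basic_free_set \<delta>" and \<xi>: "\<xi> \<in> carrier_vec (lvl y)"
  shows "\<exists>q. peval q x = f x \<and> sqn (peval q y *\<^sub>v \<xi>) \<le> B\<^sup>2 * sqn \<xi>"
proof -
  let ?W = "free_variety A \<inter> basic_free_set \<delta>"
  note W = nc_set_variety_inter[OF d, of A]
  note fW = nc_function_dsum_additive[OF W f]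
  define m where "m = lvl y"
  define n where "n = lvl x"
  have m: "m \<ge> 1" and y': "y \<in> nc_level m" using nc_setD[OF nc_set_basic_free_set[OF d] y] by (auto simp: m_def)
  have n: "n \<ge> 1" and x': "x \<in> nc_level n" using nc_setD[OF W x] by (auto simp: n_def)
  have \<xi>: "\<xi> \<in> carrier_vec m" using \<xi> by (simp add: m_def)
  have B: "0 \<le> B" using bound[OF x] mat_opnorm_nonneg[of "f x"] by linarith
  define I where "I = {p. poly_eval n p x = 0\<^sub>m n n}"
  have I0: "0 \<in> I" by (auto simp: I_def poly_eval_def intro!: eq_matI)
  have I: "p + q \<in> I" "r * p \<in> I" "p * r \<in> I" if "p \<in> I" "q \<in> I" for p q r
    using that x' by (auto simp: I_def poly_eval_add poly_eval_mult)
  define ev where "ev p = poly_eval m p y *\<^sub>v \<xi>" for p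
  define M where "M = range ev"
  define N where "N = ev ` I"
  have M: "subspace_vec m M" unfolding M_def ev_def by (rule subspace_orbit[OF y' \<xi>]) auto
  have N: "subspace_vec m N" unfolding N_def ev_def by (rule subspace_orbit[OF y' \<xi>]) (use I0 I in auto)
  have NM: "N \<subseteq> M" by (auto simp: M_def N_def)
  have ev_mult: "poly_eval m p y *\<^sub>v ev q = ev (p * q)" for p q
    unfolding ev_def using poly_eval_mult_vec[OF y' \<xi>] by simp
  obtain e V where V: "isometry e m V" and VM: "\<And>u. u \<in> carrier_vec e \<Longrightarrow> V *\<^sub>v u \<in> M"
    and VN: "\<And>n. n \<in> N \<Longrightarrow> mat_adjoint V *\<^sub>v n = 0\<^sub>v e"
    and split: "\<And>v. v \<in> M \<Longrightarrow> \<exists>n\<in>N. v = V *\<^sub>v (mat_adjoint V *\<^sub>v v) + n"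
    using isometry_onto_complement[OF M N NM] by metis
  note V' = isometryD[OF V]
  \<comment> \<open>Semi-invariance: compressing before applying a polynomial changes the compressed result by nothing,
    since the part in \<open>N\<close> stays in \<open>N\<close>.\<close>
  have semi: "mat_adjoint V *\<^sub>v (poly_eval m p y *\<^sub>v v)
      = mat_adjoint V *\<^sub>v (poly_eval m p y *\<^sub>v (V *\<^sub>v (mat_adjoint V *\<^sub>v v)))" if v: "v \<in> M" for p v
  proof -
    obtain k where k: "k \<in> N" "v = V *\<^sub>v (mat_adjoint V *\<^sub>v v) + k" using split[OF v] by blast
    let ?a = "V *\<^sub>v (mat_adjoint V *\<^sub>v v)"
    have a: "?a \<in> carrier_vec m" and kc: "k \<in> carrier_vec m" using V' subspace_vecD(1)[OF N k(1)] by auto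
    obtain c where c: "c \<in> I" "k = ev c" using k(1) by (auto simp: N_def)
    have "poly_eval m p y *\<^sub>v k \<in> N" unfolding c(2) ev_mult using I(2)[OF c(1) c(1)] by (simp add: N_def)
    then have 0: "mat_adjoint V *\<^sub>v (poly_eval m p y *\<^sub>v k) = 0\<^sub>v e" by (rule VN)
    have "mat_adjoint V *\<^sub>v (poly_eval m p y *\<^sub>v (?a + k))
        = mat_adjoint V *\<^sub>v (poly_eval m p y *\<^sub>v ?a) + mat_adjoint V *\<^sub>v (poly_eval m p y *\<^sub>v k)"
      using a kc V' by (simp add: mult_add_distrib_mat_vec[of _ m m] mult_add_distrib_mat_vec[OF V'(2)] del: assoc_mult_mat_vec)
    also have "\<dots> = mat_adjoint V *\<^sub>v (poly_eval m p y *\<^sub>v ?a)" unfolding 0 using V' by simp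
    finally show ?thesis using k(2) by metis
  qed
  \<comment> \<open>When \<open>M = N\<close> there is no compression, since points have level at least 1, and any polynomial
    with the right value at \<open>x\<close> will do.\<close>
  have "\<exists>p. poly_eval n p x = f x \<and> sqn (mat_adjoint V *\<^sub>v ev p) \<le> B\<^sup>2 * sqn \<xi>"
  proof (cases "e = 0")
    case True
    obtain p where p: "peval p x = f x" using nc_function_value_is_polynomial[OF d f x] .
    have "sqn (mat_adjoint V *\<^sub>v ev p) = 0" using True V' by (simp add: sqn_def)
    then show ?thesis using p by (auto simp: n_def)
  next
    case False
    then have e: "e \<ge> 1" by simp
    define z where "z i = mat_adjoint V * (y i * V)" for i
    have yi: "y i \<in> carrier_mat m m" for i using y' by (rule nc_levelD)
    have yV: "y i * V \<in> carrier_mat m e" for i using yi V'(1) by (rule mult_carrier_mat)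
    have zi: "z i \<in> carrier_mat e e" for i unfolding z_def using V'(2) yV by (rule mult_carrier_mat)
    have z: "z \<in> nc_level e" using zi by (simp add: nc_level_def)
    have word: "word_eval e (Nc_Word us) z *\<^sub>v u = mat_adjoint V *\<^sub>v (word_eval m (Nc_Word us) y *\<^sub>v (V *\<^sub>v u))
        \<and> word_eval m (Nc_Word us) y *\<^sub>v (V *\<^sub>v u) \<in> M" if u: "u \<in> carrier_vec e" for us u
    proof (induction us)
      case Nil
      then show ?case using u V' VM[OF u] by (simp del: assoc_mult_mat_vec)
    next
      case (Cons i us)
      let ?y = "word_eval m (Nc_Word us) y" and ?z = "word_eval e (Nc_Word us) z"
      define v where "v = ?y *\<^sub>v (V *\<^sub>v u)"
      have v: "v \<in> M" and zu: "?z *\<^sub>v u = mat_adjoint V *\<^sub>v v" using Cons by (auto simp: v_def)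
      have Vu: "V *\<^sub>v u \<in> carrier_vec m" using V' by simp
      have av: "mat_adjoint V *\<^sub>v v \<in> carrier_vec e" using V' by simp
      have "word_eval m (Nc_Word (i # us)) y *\<^sub>v (V *\<^sub>v u) = y i *\<^sub>v v"
        unfolding word_eval_Cons v_def by (rule assoc_mult_mat_vec[OF yi word_eval_carrier[OF y'] Vu])
      moreover have "word_eval e (Nc_Word (i # us)) z *\<^sub>v u = z i *\<^sub>v (mat_adjoint V *\<^sub>v v)"
        unfolding word_eval_Cons zu[symmetric] by (rule assoc_mult_mat_vec[OF zi word_eval_carrier[OF z] u])
      moreover have "z i *\<^sub>v (mat_adjoint V *\<^sub>v v) = mat_adjoint V *\<^sub>v (y i *\<^sub>v (V *\<^sub>v (mat_adjoint V *\<^sub>v v)))"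
        unfolding z_def using assoc_mult_mat_vec[OF V'(2) yV av] assoc_mult_mat_vec[OF yi V'(1) av] by metis
      moreover have "y i *\<^sub>v v \<in> M"
      proof -
        obtain p where "v = ev p" using v by (auto simp: M_def)
        then have "y i *\<^sub>v v = ev (Poly_Mapping.single (Nc_Word [i]) 1 * p)"
          using ev_mult[of "Poly_Mapping.single (Nc_Word [i]) 1" p] poly_eval_var[OF y', of i] by simp
        then show ?thesis by (simp add: M_def)
      qed
      moreover have "mat_adjoint V *\<^sub>v (y i *\<^sub>v (V *\<^sub>v (mat_adjoint V *\<^sub>v v))) = mat_adjoint V *\<^sub>v (y i *\<^sub>v v)"
        using semi[OF v, of "Poly_Mapping.single (Nc_Word [i]) 1"] poly_eval_var[OF y', of i] by simp
      ultimately show ?case by simp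
    qed
    have wz: "word_eval e w z = mat_adjoint V * word_eval m w y * V" for w
    proof (rule eq_mat_by_vec[of _ e e])
      fix u :: "complex vec" assume u: "u \<in> carrier_vec e"
      have Vu: "V *\<^sub>v u \<in> carrier_vec m" using V' by simp
      obtain us where w: "w = Nc_Word us" by (cases w)
      have "(mat_adjoint V * word_eval m w y * V) *\<^sub>v u = (mat_adjoint V * word_eval m w y) *\<^sub>v (V *\<^sub>v u)"
        by (rule assoc_mult_mat_vec[OF mult_carrier_mat[OF V'(2) word_eval_carrier[OF y']] V'(1) u])
      also have "\<dots> = mat_adjoint V *\<^sub>v (word_eval m w y *\<^sub>v (V *\<^sub>v u))"
        by (rule assoc_mult_mat_vec[OF V'(2) word_eval_carrier[OF y'] Vu])
      finally show "word_eval e w z *\<^sub>v u = (mat_adjoint V * word_eval m w y * V) *\<^sub>v u"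
        using word[OF u, of us] by (simp only: w)
    next
      show "mat_adjoint V * word_eval m w y * V \<in> carrier_mat e e"
        by (rule mult_carrier_mat[OF mult_carrier_mat[OF V'(2) word_eval_carrier[OF y']] V'(1)])
    qed (rule word_eval_carrier[OF z])
    have VpV: "(mat_adjoint V * poly_eval m p y * V) *\<^sub>v u = mat_adjoint V *\<^sub>v (poly_eval m p y *\<^sub>v (V *\<^sub>v u))"
      if u: "u \<in> carrier_vec e" for p u
    proof -
      have Vu: "V *\<^sub>v u \<in> carrier_vec m" using V' by simp
      show ?thesis
        using assoc_mult_mat_vec[OF mult_carrier_mat[OF V'(2) poly_eval_carrier(1)] V'(1) u]
          assoc_mult_mat_vec[OF V'(2) poly_eval_carrier(1) Vu] by metis
    qed
    have vanish: "mat_adjoint V * poly_eval m p y * V = 0\<^sub>m e e" if p: "p \<in> A" for p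
    proof (rule eq_mat_by_vec[of _ e e])
      fix u :: "complex vec" assume u: "u \<in> carrier_vec e"
      have "p \<in> I" using x free_variety_iff[OF x' n, of A] p by (simp add: I_def)
      moreover obtain q where q: "V *\<^sub>v u = ev q" using VM[OF u] by (auto simp: M_def)
      ultimately have "poly_eval m p y *\<^sub>v (V *\<^sub>v u) \<in> N" unfolding q ev_mult using I(3) by (simp add: N_def)
      moreover have "0\<^sub>m e e *\<^sub>v u = 0\<^sub>v e" using u by (intro eq_vecI) auto
      ultimately show "(mat_adjoint V * poly_eval m p y * V) *\<^sub>v u = 0\<^sub>m e e *\<^sub>v u"
        unfolding VpV[OF u] using VN by simp
    next
      show "mat_adjoint V * poly_eval m p y * V \<in> carrier_mat e e"
        by (rule mult_carrier_mat[OF mult_carrier_mat[OF V'(2) poly_eval_carrier(1)] V'(1)])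
    qed simp
    have zW: "z \<in> ?W" and pz: "\<And>p. poly_eval e p z = mat_adjoint V * poly_eval m p y * V"
      using compression_mem[OF d(1) V e y' y z wz vanish] by auto
    have lz: "lvl z = e" by (rule lvl_eq[OF z])
    have zx: "nc_dsum z x \<in> ?W" by (rule nc_setD(3)[OF W zW x])
    obtain p where "peval p (nc_dsum z x) = f (nc_dsum z x)" using nc_function_value_is_polynomial[OF d f zx] .
    then have "mat_dsum (peval p z) (peval p x) = mat_dsum (f z) (f x)"
      using fW dsum_additive_peval[OF W, of p] zW x by (simp add: dsum_additive_def)
    moreover have "f z \<in> carrier_mat e e" "f x \<in> carrier_mat n n"
      using fW zW x lz by (auto simp: dsum_additive_def n_def)
    ultimately have p: "poly_eval e p z = f z" "poly_eval n p x = f x"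
      using mat_dsum_inj[of "peval p z" "peval p x" "f z" "f x" e e n n] by (auto simp: lz n_def)
    let ?\<xi> = "mat_adjoint V *\<^sub>v \<xi>"
    have \<xi>M: "\<xi> \<in> M" unfolding M_def ev_def using poly_eval_one[OF y'] \<xi> by (intro image_eqI[of _ _ 1]) auto
    have "mat_adjoint V *\<^sub>v ev p = f z *\<^sub>v ?\<xi>"
      unfolding ev_def semi[OF \<xi>M] p(1)[symmetric] pz using VpV[of ?\<xi> p] V' by simp
    also have "sqn \<dots> \<le> B\<^sup>2 * sqn ?\<xi>"
      using bound[OF zW] \<open>f z \<in> carrier_mat e e\<close> V' unfolding mat_opnorm_le_iff[OF B] by auto
    also have "\<dots> \<le> B\<^sup>2 * sqn \<xi>" using isometry_adjoint_sqn[OF V \<xi>] by (intro mult_left_mono) auto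
    finally show ?thesis using p(2) by blast
  qed
  then obtain p where p: "poly_eval n p x = f x" "sqn (mat_adjoint V *\<^sub>v ev p) \<le> B\<^sup>2 * sqn \<xi>" by blast
  obtain k where k: "k \<in> N" "ev p = V *\<^sub>v (mat_adjoint V *\<^sub>v ev p) + k"
    using split[of "ev p"] by (auto simp: M_def)
  obtain c where c: "c \<in> I" "k = ev c" using k(1) by (auto simp: N_def)
  define q where "q = p + Poly_Mapping.single 0 (- 1) * c"
  have fx: "f x \<in> carrier_mat n n" using fW x by (simp add: dsum_additive_def n_def)
  have "Poly_Mapping.single 0 (- 1) * c \<in> I" using I(2) c by blast
  then have qx: "poly_eval n q x = f x" using p(1) fx by (simp add: q_def poly_eval_add I_def)
  have "ev q = ev p + (-1) \<cdot>\<^sub>v k"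
    using \<xi> y' by (simp add: ev_def q_def c(2) peval_mult_vec_add poly_eval_scale_vec)
  also have "\<dots> = V *\<^sub>v (mat_adjoint V *\<^sub>v ev p)"
  proof -
    have kc: "k \<in> carrier_vec m" using subspace_vecD(1)[OF N k(1)] .
    have "a + k + (-1) \<cdot>\<^sub>v k = a" if "a \<in> carrier_vec m" for a :: "complex vec"
      using that kc by (intro eq_vecI) auto
    from this[of "V *\<^sub>v (mat_adjoint V *\<^sub>v ev p)"] show ?thesis using k(2) V'(1) by simp
  qed
  finally have "sqn (ev q) \<le> B\<^sup>2 * sqn \<xi>"
    using p(2) isometry_sqn[OF V, of "mat_adjoint V *\<^sub>v ev p"] V'(1) by simp
  then show ?thesis using qx by (auto simp: ev_def m_def n_def)
qed

section \<open>A minimax principle\<close>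

text \<open>
  Ky Fan's condition on convexity is used, which asks for no linear structure on \<open>S\<close>. The weights
  \<open>l\<close> at which some point with \<open>h < 0\<close> makes the combination negative form an open set that contains 0, and
  those at which some point with \<open>g < 0\<close> does form an open set that contains 1. By connectedness a common weight
  exists, and on the segment between the two points there is one where the interpolated values of \<open>h\<close> and \<open>g\<close>
  agree; the common value is negative.
\<close>

lemma common_negative_point_two:
  fixes h g :: "'a \<Rightarrow> real"
  assumes conv: "\<And>p q u. p \<in> S \<Longrightarrow> q \<in> S \<Longrightarrow> 0 \<le> u \<Longrightarrow> u \<le> 1 \<Longrightarrow>
      \<exists>r\<in>S. h r \<le> (1 - u) * h p + u * h q \<and> g r \<le> (1 - u) * g p + u * g q"
    and neg: "\<And>l. 0 \<le> l \<Longrightarrow> l \<le> 1 \<Longrightarrow> \<exists>q\<in>S. (1 - l) * h q + l * g q < 0"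
  shows "\<exists>q\<in>S. h q < 0 \<and> g q < 0"
proof -
  define U where "U = (\<Union>q\<in>{q \<in> S. h q < 0}. {l. (1 - l) * h q + l * g q < 0})"
  define U' where "U' = (\<Union>q\<in>{q \<in> S. g q < 0}. {l. (1 - l) * h q + l * g q < 0})"
  have "open U" "open U'"
    unfolding U_def U'_def by (intro open_UN ballI open_Collect_less continuous_intros)+
  moreover have "{0..1} \<subseteq> U \<union> U'"
  proof
    fix l :: real assume l: "l \<in> {0..1}"
    then obtain q where q: "q \<in> S" "(1 - l) * h q + l * g q < 0" using neg by auto
    then have "h q < 0 \<or> g q < 0"
      using l by (smt (verit) atLeastAtMost_iff mult_nonneg_nonneg)
    then show "l \<in> U \<union> U'" using q by (auto simp: U_def U'_def)
  qed
  moreover have "0 \<in> U" using neg[of 0] by (auto simp: U_def)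
  moreover have "1 \<in> U'" using neg[of 1] by (auto simp: U'_def)
  ultimately have "U \<inter> U' \<inter> {0..1} \<noteq> {}"
    using connectedD[OF connected_Icc, of U U' 0 "1 :: real"] by fastforce
  then obtain l p q where l: "0 \<le> l" "l \<le> 1" and p: "p \<in> S" "h p < 0" "(1 - l) * h p + l * g p < 0"
    and q: "q \<in> S" "g q < 0" "(1 - l) * h q + l * g q < 0"
    by (auto simp: U_def U'_def)
  show ?thesis
  proof (cases "g p < 0 \<or> h q < 0")
    case True
    then show ?thesis using p q by blast
  next
    case False
    define a where "a = g p - h p"
    define b where "b = h q - g q"
    have ab: "a > 0" "b > 0" using False p q by (auto simp: a_def b_def)
    \<comment> \<open>The parameter at which the interpolated values of \<open>h\<close> and \<open>g\<close> agree.\<close>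
    define u where "u = a / (a + b)"
    have u: "0 \<le> u" "u \<le> 1" using ab by (auto simp: u_def)
    have eq: "(1 - u) * h p + u * h q = (1 - u) * g p + u * g q" (is "?c = _")
    proof -
      have "u * b = (1 - u) * a" using ab by (simp add: u_def field_simps)
      then show ?thesis by (simp add: a_def b_def algebra_simps)
    qed
    have "?c = (1 - l) * ?c + l * ((1 - u) * g p + u * g q)" unfolding eq[symmetric] by (simp add: algebra_simps)
    also have "\<dots> = (1 - u) * ((1 - l) * h p + l * g p) + u * ((1 - l) * h q + l * g q)"
      by (simp add: algebra_simps)
    also have "\<dots> < 0"
    proof (cases "u = 0")
      case True
      then show ?thesis using p by simp
    next
      case False
      have "(1 - u) * ((1 - l) * h p + l * g p) \<le> 0" using u p by (intro mult_nonneg_nonpos) auto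
      moreover have "u * ((1 - l) * h q + l * g q) < 0" using False u q by (intro mult_pos_neg) auto
      ultimately show ?thesis by linarith
    qed
    finally have "?c < 0" .
    moreover obtain r where "r \<in> S" "h r \<le> ?c" "g r \<le> (1 - u) * g p + u * g q"
      using conv[OF p(1) q(1) u] by blast
    ultimately show ?thesis using eq by (intro bexI[of _ r]) auto
  qed
qed

text \<open>
  Induction on the number of functions: one function is turned into a constraint on \<open>S\<close>, and the
  two-function case, for it and a weighted sum of the others, shows that the hypothesis survives the constraint.
\<close>

lemma common_negative_point:
  fixes g :: "'i \<Rightarrow> 'a \<Rightarrow> real"
  assumes "finite I" "I \<noteq> {}"
    and "\<And>p q u. p \<in> S \<Longrightarrow> q \<in> S \<Longrightarrow> 0 \<le> u \<Longrightarrow> u \<le> 1 \<Longrightarrow>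
      \<exists>r\<in>S. \<forall>i\<in>I. g i r \<le> (1 - u) * g i p + u * g i q"
    and "\<And>t. (\<And>i. i \<in> I \<Longrightarrow> 0 \<le> t i) \<Longrightarrow> \<exists>i\<in>I. 0 < t i \<Longrightarrow> \<exists>q\<in>S. (\<Sum>i\<in>I. t i * g i q) < 0"
  shows "\<exists>q\<in>S. \<forall>i\<in>I. g i q < 0"
  using assms
proof (induction I arbitrary: S rule: finite_ne_induct)
  case (singleton i)
  show ?case using singleton(2)[of "\<lambda>_. 1"] by auto
next
  case (insert j I)
  let ?S = "{q \<in> S. g j q < 0}"
  have "\<exists>q\<in>?S. \<forall>i\<in>I. g i q < 0"
  proof (rule insert.IH)
    fix p q and u :: real assume pq: "p \<in> ?S" "q \<in> ?S" and u: "0 \<le> u" "u \<le> 1"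
    then obtain r where r: "r \<in> S" "\<forall>i\<in>insert j I. g i r \<le> (1 - u) * g i p + u * g i q"
      using insert.prems(1) by blast
    have "(1 - u) * g j p + u * g j q < 0"
    proof (cases "u = 0")
      case True
      then show ?thesis using pq by simp
    next
      case False
      have "(1 - u) * g j p \<le> 0" using u pq by (intro mult_nonneg_nonpos) auto
      moreover have "u * g j q < 0" using False u pq by (intro mult_pos_neg) auto
      ultimately show ?thesis by linarith
    qed
    then have "g j r < 0" using r(2) by fastforce
    then show "\<exists>r\<in>?S. \<forall>i\<in>I. g i r \<le> (1 - u) * g i p + u * g i q" using r by blast
  next
    fix t :: "'i \<Rightarrow> real" assume t: "\<And>i. i \<in> I \<Longrightarrow> 0 \<le> t i" "\<exists>i\<in>I. 0 < t i"
    define h where "h q = (\<Sum>i\<in>I. t i * g i q)" for q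
    have "\<exists>q\<in>S. h q < 0 \<and> g j q < 0"
    proof (rule common_negative_point_two)
      fix p q and u :: real assume pq: "p \<in> S" "q \<in> S" and u: "0 \<le> u" "u \<le> 1"
      then obtain r where r: "r \<in> S" "\<forall>i\<in>insert j I. g i r \<le> (1 - u) * g i p + u * g i q"
        using insert.prems(1) by blast
      have "h r \<le> (\<Sum>i\<in>I. t i * ((1 - u) * g i p + u * g i q))"
        unfolding h_def using r(2) t(1) by (intro sum_mono mult_left_mono) auto
      also have "\<dots> = (1 - u) * h p + u * h q"
        by (simp add: h_def distrib_left sum.distrib sum_distrib_left mult_ac)
      finally show "\<exists>r\<in>S. h r \<le> (1 - u) * h p + u * h q \<and> g j r \<le> (1 - u) * g j p + u * g j q"
        using r by blast
    next
      fix l :: real assume l: "0 \<le> l" "l \<le> 1"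
      \<comment> \<open>A combination of \<open>h\<close> and \<open>g j\<close> is again a weighted sum over the larger index set.\<close>
      define t' where "t' i = (if i = j then l else (1 - l) * t i)" for i
      have "\<exists>i\<in>insert j I. 0 < t' i"
      proof (cases "l = 0")
        case True
        obtain i where "i \<in> I" "0 < t i" using t(2) by blast
        then have "0 < t' i" "i \<in> insert j I" using True insert.hyps by (auto simp: t'_def)
        then show ?thesis by blast
      qed (use l in \<open>auto simp: t'_def\<close>)
      moreover have "0 \<le> t' i" if "i \<in> insert j I" for i
        using that t(1) l by (auto simp: t'_def)
      ultimately obtain q where q: "q \<in> S" "(\<Sum>i\<in>insert j I. t' i * g i q) < 0"
        using insert.prems(2)[of t'] by blast
      have "(\<Sum>i\<in>I. t' i * g i q) = (1 - l) * h q"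
        using insert.hyps unfolding h_def sum_distrib_left
        by (intro sum.cong) (auto simp: t'_def)
      then have "(\<Sum>i\<in>insert j I. t' i * g i q) = (1 - l) * h q + l * g j q"
        using insert.hyps by (simp add: t'_def)
      then show "\<exists>q\<in>S. (1 - l) * h q + l * g j q < 0" using q by auto
    qed
    then show "\<exists>q\<in>?S. (\<Sum>i\<in>I. t i * g i q) < 0" by (auto simp: h_def)
  qed
  then show ?case by auto
qed

section \<open>Interpolation at finitely many vectors\<close>

lemma sqn_convex:
  assumes a: "a \<in> carrier_vec n" and b: "b \<in> carrier_vec n" and u: "0 \<le> u" "u \<le> 1"
  shows "sqn (complex_of_real (1 - u) \<cdot>\<^sub>v a + complex_of_real u \<cdot>\<^sub>v b) \<le> (1 - u) * sqn a + u * sqn b"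
proof -
  have *: "(cmod (complex_of_real (1 - u) * x + complex_of_real u * y))\<^sup>2 \<le> (1 - u) * (cmod x)\<^sup>2 + u * (cmod y)\<^sup>2"
    for x y
  proof -
    have "cmod (complex_of_real (1 - u) * x + complex_of_real u * y)
        \<le> cmod (complex_of_real (1 - u) * x) + cmod (complex_of_real u * y)"
      by (rule norm_triangle_ineq)
    also have "\<dots> = (1 - u) * cmod x + u * cmod y"
      using u by (simp add: norm_mult del: of_real_diff)
    finally have "(cmod (complex_of_real (1 - u) * x + complex_of_real u * y))\<^sup>2 \<le> ((1 - u) * cmod x + u * cmod y)\<^sup>2"
      by (rule power_mono) simp
    also have "\<dots> = (1 - u) * (cmod x)\<^sup>2 + u * (cmod y)\<^sup>2 - u * (1 - u) * (cmod x - cmod y)\<^sup>2"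
      by (simp add: power2_eq_square algebra_simps)
    also have "\<dots> \<le> (1 - u) * (cmod x)\<^sup>2 + u * (cmod y)\<^sup>2" using u by simp
    finally show ?thesis .
  qed
  have "sqn (complex_of_real (1 - u) \<cdot>\<^sub>v a + complex_of_real u \<cdot>\<^sub>v b)
      = (\<Sum>i<n. (cmod (complex_of_real (1 - u) * a $ i + complex_of_real u * b $ i))\<^sup>2)"
    using a b by (auto simp: sqn_def simp del: of_real_diff intro!: sum.cong)
  also have "\<dots> \<le> (\<Sum>i<n. (1 - u) * (cmod (a $ i))\<^sup>2 + u * (cmod (b $ i))\<^sup>2)"
    by (intro sum_mono *)
  also have "\<dots> = (1 - u) * sqn a + u * sqn b"
    using a b by (simp add: sqn_def sum.distrib sum_distrib_left)
  finally show ?thesis .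
qed

text \<open>
  A weighted sum of the conditions, with weights \<open>t\<close>, is one condition on the direct sum of the
  points and of the vectors scaled by the square roots of \<open>t\<close>, where the previous interpolation result
  applies. The minimax principle turns solvability of all weighted sums into simultaneous solvability; the
  slack \<open>\<epsilon>\<close> makes the inequalities strict, as the principle demands.
\<close>

lemma finite_interpolation:
  fixes f :: "'d nc_point \<Rightarrow> complex mat"
  assumes d: "\<delta> \<in> carrier_mat J J" "J \<ge> 1"
    and f: "nc_function_on (free_variety A \<inter> basic_free_set \<delta>) f"
    and bound: "\<And>x. x \<in> free_variety A \<inter> basic_free_set \<delta> \<Longrightarrow> mat_opnorm (f x) \<le> B"
    and x: "x \<in> free_variety A \<inter> basic_free_set \<delta>"
    and T: "finite T" "\<And>y \<xi> \<epsilon>. (y, \<xi>, \<epsilon>) \<in> T \<Longrightarrow> y \<in> basic_free_set \<delta> \<and> \<xi> \<in> carrier_vec (lvl y) \<and> 0 < \<epsilon>"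
  shows "\<exists>q. peval q x = f x \<and> (\<forall>(y, \<xi>, \<epsilon>)\<in>T. sqn (peval q y *\<^sub>v \<xi>) \<le> B\<^sup>2 * sqn \<xi> + \<epsilon>)"
proof (cases "T = {}")
  case True
  obtain p where "peval p x = f x" using nc_function_value_is_polynomial[OF d f x] .
  then show ?thesis using True by auto
next
  case False
  let ?W = "free_variety A \<inter> basic_free_set \<delta>" and ?G = "basic_free_set \<delta>"
  note W = nc_set_variety_inter[OF d, of A] and G = nc_set_basic_free_set[OF d]
  have xl: "x \<in> nc_level (lvl x)" using nc_setD(2)[OF W x] .
  have fx: "f x \<in> carrier_mat (lvl x) (lvl x)"
    using nc_function_dsum_additive[OF W f] x by (simp add: dsum_additive_def)
  define g :: "'d nc_point \<times> complex vec \<times> real \<Rightarrow> 'd free_poly \<Rightarrow> real" where "g = (\<lambda>(y, \<xi>, \<epsilon>) q. sqn (peval q y *\<^sub>v \<xi>) - B\<^sup>2 * sqn \<xi> - \<epsilon>)"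
  have "\<exists>q\<in>{q. peval q x = f x}. \<forall>i\<in>T. g i q < 0"
  proof (rule common_negative_point[OF T(1) False])
    fix p q and u :: real
    assume pq: "p \<in> {q. peval q x = f x}" "q \<in> {q. peval q x = f x}" and u: "0 \<le> u" "u \<le> 1"
    let ?r = "Poly_Mapping.single 0 (complex_of_real (1 - u)) * p + Poly_Mapping.single 0 (complex_of_real u) * q"
    have "complex_of_real (1 - u) \<cdot>\<^sub>m f x + complex_of_real u \<cdot>\<^sub>m f x = f x"
      using fx by (intro eq_matI) (auto simp: algebra_simps)
    then have "peval ?r x = f x" using pq by (simp add: poly_eval_add poly_eval_scale[OF xl] del: of_real_diff)
    moreover have "g i ?r \<le> (1 - u) * g i p + u * g i q" if i: "i \<in> T" for i
    proof -
      obtain y \<xi> \<epsilon> where ieq: "i = (y, \<xi>, \<epsilon>)" by (cases i) auto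
      have y: "y \<in> nc_level (lvl y)" and \<xi>: "\<xi> \<in> carrier_vec (lvl y)"
        using T(2) i nc_setD(2)[OF G] by (auto simp: ieq)
      have "sqn (peval ?r y *\<^sub>v \<xi>) \<le> (1 - u) * sqn (peval p y *\<^sub>v \<xi>) + u * sqn (peval q y *\<^sub>v \<xi>)"
        unfolding peval_mult_vec_add[OF \<xi>] poly_eval_scale_vec[OF y \<xi>]
        by (rule sqn_convex[of _ "lvl y"]) (use u in auto)
      then show ?thesis by (simp add: g_def ieq algebra_simps)
    qed
    ultimately show "\<exists>r\<in>{q. peval q x = f x}. \<forall>i\<in>T. g i r \<le> (1 - u) * g i p + u * g i q" by blast
  next
    fix t :: "'d nc_point \<times> complex vec \<times> real \<Rightarrow> real"
    assume t: "\<And>i. i \<in> T \<Longrightarrow> 0 \<le> t i" "\<exists>i\<in>T. 0 < t i"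
    obtain ts where ts: "set ts = T" "distinct ts" using finite_distinct_list[OF T(1)] by blast
    \<comment> \<open>Scaling by the square root of \<open>t i\<close> multiplies the squared norm by \<open>t i\<close>.\<close>
    define xs where "xs = map (\<lambda>i. (fst i, complex_of_real (sqrt (t i)) \<cdot>\<^sub>v fst (snd i))) ts"
    have "xs \<noteq> []" using False ts by (auto simp: xs_def)
    moreover have "y \<in> ?G \<and> \<xi> \<in> carrier_vec (lvl y)" if "(y, \<xi>) \<in> set xs" for y \<xi>
      using that T(2) by (auto simp: xs_def ts)
    ultimately obtain Y \<Xi> where Y: "Y \<in> ?G" "\<Xi> \<in> carrier_vec (lvl Y)"
      and eq: "\<And>\<phi>. dsum_additive ?G \<phi> \<Longrightarrow> sqn (\<phi> Y *\<^sub>v \<Xi>) = (\<Sum>(x, \<xi>)\<leftarrow>xs. sqn (\<phi> x *\<^sub>v \<xi>))"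
      using direct_sum_of_list[OF G, of xs] by blast
    have sq: "sqn (peval p Y *\<^sub>v \<Xi>) = (\<Sum>i\<in>T. t i * sqn (peval p (fst i) *\<^sub>v fst (snd i)))" for p
    proof -
      have "sqn (peval p Y *\<^sub>v \<Xi>) = (\<Sum>i\<leftarrow>ts. sqn (peval p (fst i) *\<^sub>v (complex_of_real (sqrt (t i)) \<cdot>\<^sub>v fst (snd i))))"
        using eq[OF dsum_additive_peval[OF G]] by (simp add: xs_def comp_def case_prod_unfold)
      also have "\<dots> = (\<Sum>i\<in>T. sqn (peval p (fst i) *\<^sub>v (complex_of_real (sqrt (t i)) \<cdot>\<^sub>v fst (snd i))))"
        using ts by (simp add: sum_list_distinct_conv_sum_set)
      also have "\<dots> = (\<Sum>i\<in>T. t i * sqn (peval p (fst i) *\<^sub>v fst (snd i)))"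
      proof (rule sum.cong[OF refl])
        fix i assume i: "i \<in> T"
        have "fst (snd i) \<in> carrier_vec (lvl (fst i))" using T(2)[of "fst i" "fst (snd i)" "snd (snd i)"] i by simp
        then show "sqn (peval p (fst i) *\<^sub>v (complex_of_real (sqrt (t i)) \<cdot>\<^sub>v fst (snd i))) = t i * sqn (peval p (fst i) *\<^sub>v fst (snd i))"
          using t(1)[OF i] by (simp add: mult_mat_vec[OF poly_eval_carrier(1)] sqn_smult)
      qed
      finally show ?thesis .
    qed
    obtain q where q: "peval q x = f x" "sqn (peval q Y *\<^sub>v \<Xi>) \<le> B\<^sup>2 * sqn \<Xi>"
      using pointwise_interpolation[OF d f bound x Y] by blast
    have one: "sqn (peval 1 y *\<^sub>v \<xi>) = sqn \<xi>" if "y \<in> ?G" "\<xi> \<in> carrier_vec (lvl y)" for y \<xi>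
      using poly_eval_one[OF nc_setD(2)[OF G that(1)]] that(2) by simp
    have "sqn \<Xi> = (\<Sum>i\<in>T. t i * sqn (peval 1 (fst i) *\<^sub>v fst (snd i)))" using sq[of 1] one[OF Y] by simp
    also have "\<dots> = (\<Sum>i\<in>T. t i * sqn (fst (snd i)))"
      using T(2) by (intro sum.cong refl arg_cong2[of _ _ _ _ "(*)"] one) (metis prod.collapse)+
    finally have \<Xi>: "sqn \<Xi> = (\<Sum>i\<in>T. t i * sqn (fst (snd i)))" .
    have "(\<Sum>i\<in>T. t i * g i q) = sqn (peval q Y *\<^sub>v \<Xi>) - B\<^sup>2 * sqn \<Xi> - (\<Sum>i\<in>T. t i * snd (snd i))"
      unfolding sq \<Xi> g_def
      by (simp add: case_prod_unfold algebra_simps sum.distrib sum_subtractf sum_distrib_left)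
    also have "\<dots> < 0"
    proof -
      have \<epsilon>: "0 < snd (snd i)" if "i \<in> T" for i using T(2)[of "fst i" "fst (snd i)" "snd (snd i)"] that by simp
      obtain i where "i \<in> T" "0 < t i" using t(2) by blast
      then have "0 < (\<Sum>i\<in>T. t i * snd (snd i))"
        using t(1) \<epsilon> by (intro sum_pos2[OF T(1), of i]) (simp_all add: less_imp_le)
      then show ?thesis using q(2) by linarith
    qed
    finally show "\<exists>q\<in>{q. peval q x = f x}. (\<Sum>i\<in>T. t i * g i q) < 0" using q(1) by blast
  qed
  then show ?thesis by (force simp: g_def)
qed

section \<open>From local to global nc functions\<close>

text \<open>
  The function \<open>f\<close> is only locally the restriction of nc functions, but a single local representation
  near \<open>x \<oplus> y\<close> is also one near \<open>x\<close> and near \<open>y\<close>, because basic free open sets contain the summands of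
  their points. Applied to \<open>x\<close> and a point similar to it this gives the similarity condition as well.
\<close>

lemma free_holomorphic_rel_nc_function:
  assumes d: "\<delta> \<in> carrier_mat J J" "J \<ge> 1"
    and f: "free_holomorphic_rel (free_variety A) (basic_free_set \<delta>) f"
  shows "nc_function_on (free_variety A \<inter> basic_free_set \<delta>) f"
proof -
  let ?W = "free_variety A \<inter> basic_free_set \<delta>"
  note W = nc_set_variety_inter[OF d, of A]
  have local: "\<exists>J' \<delta>' \<psi>. J' \<ge> 1 \<and> \<delta>' \<in> carrier_mat J' J' \<and> x \<in> basic_free_set \<delta>'
      \<and> nc_function_on (basic_free_set \<delta>') \<psi> \<and> (\<forall>y \<in> free_variety A \<inter> basic_free_set \<delta>'. \<psi> y = f y)"
    if x: "x \<in> ?W" for x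
  proof -
    obtain G \<psi> where G: "x \<in> G" "free_holomorphic_on G \<psi>" "\<forall>y\<in>free_variety A \<inter> G. \<psi> y = f y"
      using f x unfolding free_holomorphic_rel_def by blast
    obtain G' where G': "basic_free_open G'" "x \<in> G'" "G' \<subseteq> G" "nc_function_on G' \<psi>"
      using G unfolding free_holomorphic_on_def by blast
    obtain J' \<delta>' where "J' \<ge> 1" "\<delta>' \<in> carrier_mat J' J'" "G' = basic_free_set \<delta>'"
      using G'(1) unfolding basic_free_open_def by blast
    then show ?thesis using G G' by blast
  qed
  show ?thesis
    unfolding nc_function_on_def graded_on_def
  proof (intro conjI allI impI ballI)
    fix n :: nat and x assume n: "1 \<le> n" and x: "x \<in> ?W \<inter> nc_level n"
    obtain J' \<delta>' \<psi> where l: "J' \<ge> 1" "\<delta>' \<in> carrier_mat J' J'" "x \<in> basic_free_set \<delta>'"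
      "nc_function_on (basic_free_set \<delta>') \<psi>" "\<forall>y \<in> free_variety A \<inter> basic_free_set \<delta>'. \<psi> y = f y"
      using local[of x] x by blast
    have "\<psi> x \<in> carrier_mat n n" using l(3,4) n x unfolding nc_function_on_def graded_on_def by blast
    then show "f x \<in> carrier_mat n n" using l x by auto
  next
    fix x y assume xy: "x \<in> ?W \<and> y \<in> ?W \<and> nc_dsum x y \<in> ?W"
    obtain J' \<delta>' \<psi> where l: "J' \<ge> 1" "\<delta>' \<in> carrier_mat J' J'" "nc_dsum x y \<in> basic_free_set \<delta>'"
      "nc_function_on (basic_free_set \<delta>') \<psi>" "\<forall>y \<in> free_variety A \<inter> basic_free_set \<delta>'. \<psi> y = f y"
      using local[of "nc_dsum x y"] xy by blast
    have "x \<in> basic_free_set \<delta>' \<and> y \<in> basic_free_set \<delta>'"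
      using basic_free_set_dsum[of x "lvl x" y "lvl y" \<delta>' J'] nc_setD(1,2)[OF W] xy l by blast
    moreover from this have "\<psi> (nc_dsum x y) = mat_dsum (\<psi> x) (\<psi> y)"
      using l(3,4) by (simp add: nc_function_on_def)
    ultimately show "f (nc_dsum x y) = mat_dsum (f x) (f y)" using l xy by auto
  next
    fix n s t x
    assume n: "1 \<le> n" and s: "s \<in> carrier_mat n n" and t: "t \<in> carrier_mat n n"
      and a: "inverts_mat s t \<and> inverts_mat t s \<and> x \<in> ?W \<inter> nc_level n \<and> (\<lambda>i. t * x i * s) \<in> ?W \<inter> nc_level n"
    let ?y = "\<lambda>i. t * x i * s"
    have x: "x \<in> ?W" "x \<in> nc_level n" and y: "?y \<in> ?W" "?y \<in> nc_level n" using a by auto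
    obtain J' \<delta>' \<psi> where l: "J' \<ge> 1" "\<delta>' \<in> carrier_mat J' J'" "nc_dsum x ?y \<in> basic_free_set \<delta>'"
      "nc_function_on (basic_free_set \<delta>') \<psi>" "\<forall>y \<in> free_variety A \<inter> basic_free_set \<delta>'. \<psi> y = f y"
      using local[of "nc_dsum x ?y"] nc_setD(3)[OF W x(1) y(1)] by blast
    have xy': "x \<in> basic_free_set \<delta>'" "?y \<in> basic_free_set \<delta>'"
      using basic_free_set_dsum[OF x(2) n y(2) n l(2,1)] l(3) by auto
    have "\<forall>n\<ge>1. \<forall>s\<in>carrier_mat n n. \<forall>t\<in>carrier_mat n n. \<forall>x.
          inverts_mat s t \<and> inverts_mat t s \<and> x \<in> basic_free_set \<delta>' \<inter> nc_level n
          \<and> (\<lambda>i. t * x i * s) \<in> basic_free_set \<delta>' \<inter> nc_level n \<longrightarrow> \<psi> (\<lambda>i. t * x i * s) = t * \<psi> x * s"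
      using l(4) by (simp add: nc_function_on_def)
    from this[rule_format, OF n s t, of x] have "\<psi> ?y = t * \<psi> x * s" using a xy' by blast
    then show "f ?y = t * f x * s" using l(5) x y xy' by auto
  qed
qed

section \<open>Passage to the limit\<close>

lemma compact_disc: "compact {z :: complex. cmod z \<le> C}"
proof -
  let ?c = "\<lambda>p :: real \<times> real. complex_of_real (fst p) + \<i> * complex_of_real (snd p)"
  let ?Q = "{-C..C} \<times> {-C..C}"
  have "compact (?c ` ?Q)"
    by (intro compact_continuous_image compact_Times compact_Icc continuous_intros)
  moreover have "closed {z :: complex. cmod z \<le> C}"
    by (intro closed_Collect_le continuous_intros)
  moreover have "{z :: complex. cmod z \<le> C} \<subseteq> ?c ` ?Q"
  proof
    fix z :: complex assume "z \<in> {z. cmod z \<le> C}"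
    then have "(Re z, Im z) \<in> ?Q" using abs_Re_le_cmod[of z] abs_Im_le_cmod[of z] by auto
    moreover have "z = ?c (Re z, Im z)" by (simp add: complex_eq)
    ultimately show "z \<in> ?c ` ?Q" by blast
  qed
  ultimately show ?thesis by (metis compact_Int_closed inf.absorb_iff2)
qed

lemma compact_bounded_functions:
  "compact {g :: 'k \<Rightarrow> complex. \<forall>k. cmod (g k) \<le> C}"
proof -
  have "compactin (product_topology (\<lambda>_ :: 'k. euclidean :: complex topology) UNIV)
      (PiE UNIV (\<lambda>_. {z. cmod z \<le> C}))"
    by (subst compactin_PiE) (simp add: compact_disc)
  moreover have "PiE UNIV (\<lambda>_ :: 'k. {z. cmod z \<le> C}) = {g :: 'k \<Rightarrow> complex. \<forall>k. cmod (g k) \<le> C}"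
    by (auto simp: PiE_UNIV_domain Pi_def)
  ultimately show ?thesis
    by (simp add: euclidean_product_topology)
qed

text \<open>
  The sets \<open>K T\<close> form a filter base in a compact space; \<open>g\<close> is a cluster point of it. It inherits
  every closed condition that holds on some \<open>K T\<close>.
\<close>

lemma directed_limit:
  assumes X: "compact X" and K: "\<And>T. finite T \<Longrightarrow> T \<subseteq> \<T> \<Longrightarrow> K T \<noteq> {}" "\<And>T. K T \<subseteq> X"
    and mono: "\<And>T T'. T \<subseteq> T' \<Longrightarrow> K T' \<subseteq> K T"
  obtains g where "\<And>T C. finite T \<Longrightarrow> T \<subseteq> \<T> \<Longrightarrow> K T \<subseteq> C \<Longrightarrow> closed C \<Longrightarrow> g \<in> C"
proof -
  let ?I = "{T. finite T \<and> T \<subseteq> \<T>}"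
  have "X \<inter> (\<Inter>T\<in>?I. closure (K T)) \<noteq> {}"
  proof (rule compact_imp_fip_image[OF X])
    fix I' assume I': "finite I'" "I' \<subseteq> ?I"
    then have "finite (\<Union>I')" "\<Union>I' \<subseteq> \<T>" by auto
    then obtain g where g: "g \<in> K (\<Union>I')" using K(1) by blast
    then have "g \<in> closure (K T)" if "T \<in> I'" for T
      using mono[of T "\<Union>I'"] that closure_subset by blast
    then show "X \<inter> (\<Inter>T\<in>I'. closure (K T)) \<noteq> {}" using g K(2) by blast
  qed auto
  then obtain g where g: "\<And>T. T \<in> ?I \<Longrightarrow> g \<in> closure (K T)" by blast
  show ?thesis
    by (rule that[of g]) (use g closure_minimal in blast)
qed

text \<open>
  A function is encoded by its matrix entries, as a point of the product of closed discs indexed by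
  \<open>(x, i, j)\<close>. For a finite set \<open>T\<close> of triples \<open>(y, \<xi>, \<epsilon>)\<close>, the set \<open>K T\<close> consists of the points that agree at
  all \<open>y\<close> in \<open>T\<close> with one polynomial \<open>q\<close> that has the value \<open>f(y)\<close> at those \<open>y\<close> that lie in \<open>V \<inter> G\<^sub>\<delta>\<close> and satisfies
  \<open>|q(y)\<xi>|\<^sup>2 \<le> B\<^sup>2 |\<xi>|\<^sup>2 + \<epsilon>\<close> for each triple.
  Being an nc function, extending \<open>f\<close> and having norm at most \<open>B\<close> are conjunctions of closed conditions, each on
  finitely many points, so a cluster point satisfies all of them.
\<close>

lemma bounded_nc_extension:
  fixes f :: "'d nc_point \<Rightarrow> complex mat"
  assumes d: "\<delta> \<in> carrier_mat J J" "J \<ge> 1"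
    and f: "nc_function_on (free_variety A \<inter> basic_free_set \<delta>) f"
    and bound: "\<And>x. x \<in> free_variety A \<inter> basic_free_set \<delta> \<Longrightarrow> mat_opnorm (f x) \<le> B"
    and ne: "free_variety A \<inter> basic_free_set \<delta> \<noteq> {}"
  obtains \<phi> where "nc_function_on (basic_free_set \<delta>) \<phi>"
    "\<And>x. x \<in> free_variety A \<inter> basic_free_set \<delta> \<Longrightarrow> \<phi> x = f x"
    "\<And>x. x \<in> basic_free_set \<delta> \<Longrightarrow> mat_opnorm (\<phi> x) \<le> B"
proof -
  let ?W = "free_variety A \<inter> basic_free_set \<delta>" and ?G = "basic_free_set \<delta>"
  note W = nc_set_variety_inter[OF d, of A] and G = nc_set_basic_free_set[OF d]
  note fW = nc_function_dsum_additive[OF W f]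
  obtain w where w: "w \<in> ?W" using ne by blast
  have B: "0 \<le> B" using bound[OF w] mat_opnorm_nonneg[of "f w"] by linarith
  define C where "C = sqrt (B\<^sup>2 + 1)"
  define X where "X = {g :: 'd nc_point \<times> nat \<times> nat \<Rightarrow> complex. \<forall>k. cmod (g k) \<le> C}"
  define \<T> where "\<T> = {(y :: 'd nc_point, \<xi> :: complex vec, \<epsilon> :: real). y \<in> ?G \<and> \<xi> \<in> carrier_vec (lvl y) \<and> 0 < \<epsilon>}"
  define good where "good q = (\<lambda>(g :: 'd nc_point \<times> nat \<times> nat \<Rightarrow> complex) (y, \<xi>, \<epsilon>).
      (\<forall>i<lvl y. \<forall>j<lvl y. g (y, i, j) = peval q y $$ (i, j))
      \<and> sqn (peval q y *\<^sub>v \<xi>) \<le> B\<^sup>2 * sqn \<xi> + \<epsilon> \<and> (y \<in> ?W \<longrightarrow> peval q y = f y))" for q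
  define K where "K T = {g \<in> X. \<exists>q. \<forall>k\<in>T. good q g k}" for T
  have K_nonempty: "K T \<noteq> {}" if T: "finite T" "T \<subseteq> \<T>" for T
  proof -
    \<comment> \<open>The basis vectors with slack 1 are added only to keep the entries inside the disc of radius \<open>C\<close>.\<close>
    define T' where "T' = T \<union> (\<Union>(y, \<xi>, \<epsilon>)\<in>T. (\<lambda>j. (y, unit_vec (lvl y) j, 1)) ` {..<lvl y})"
    have T': "finite T'" "\<And>y \<xi> \<epsilon>. (y, \<xi>, \<epsilon>) \<in> T' \<Longrightarrow> y \<in> ?G \<and> \<xi> \<in> carrier_vec (lvl y) \<and> 0 < \<epsilon>"
      using T by (auto simp: T'_def \<T>_def)
    \<comment> \<open>The point \<open>w\<close> makes the set nonempty when no point of \<open>T\<close> lies on the variety.\<close>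
    have "finite (insert w (fst ` T \<inter> ?W))" "insert w (fst ` T \<inter> ?W) \<subseteq> ?W" using T(1) w by auto
    then obtain x where x: "x \<in> ?W" and eq: "\<And>\<phi> \<psi> y. dsum_additive ?W \<phi> \<Longrightarrow> dsum_additive ?W \<psi> \<Longrightarrow> \<phi> x = \<psi> x
        \<Longrightarrow> y \<in> fst ` T \<inter> ?W \<Longrightarrow> \<phi> y = \<psi> y"
      using direct_sum_of_points[OF W, of "insert w (fst ` T \<inter> ?W)"] by blast
    obtain q where q: "peval q x = f x" "\<forall>(y, \<xi>, \<epsilon>)\<in>T'. sqn (peval q y *\<^sub>v \<xi>) \<le> B\<^sup>2 * sqn \<xi> + \<epsilon>"
      using finite_interpolation[OF d f bound x T'] by blast
    define g where "g = (\<lambda>(y, i, j). if y \<in> fst ` T \<and> i < lvl y \<and> j < lvl y then peval q y $$ (i, j) else 0)"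
    have "cmod (g (y, i, j)) \<le> C" for y i j
    proof (cases "y \<in> fst ` T \<and> i < lvl y \<and> j < lvl y")
      case True
      then have "(y, unit_vec (lvl y) j, 1) \<in> T'" by (force simp: T'_def)
      then have "sqn (peval q y *\<^sub>v unit_vec (lvl y) j) \<le> B\<^sup>2 + 1"
        using q(2) True sqn_unit_vec[of j "lvl y"] by fastforce
      moreover have "(cmod (peval q y $$ (i, j)))\<^sup>2 \<le> sqn (peval q y *\<^sub>v unit_vec (lvl y) j)"
      proof -
        have "(cmod ((peval q y *\<^sub>v unit_vec (lvl y) j) $ i))\<^sup>2 \<le> sqn (peval q y *\<^sub>v unit_vec (lvl y) j)"
          unfolding sqn_def by (rule member_le_sum) (use True in auto)
        then show ?thesis using True by simp
      qed
      ultimately show ?thesis using True by (simp add: g_def C_def real_le_rsqrt)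
    next
      case False
      then show ?thesis by (auto simp: g_def C_def)
    qed
    then have "g \<in> X" by (auto simp: X_def)
    moreover have "good q g k" if k: "k \<in> T" for k
    proof -
      obtain y \<xi> \<epsilon> where ke: "k = (y, \<xi>, \<epsilon>)" by (cases k) auto
      have yT: "y \<in> fst ` T" using k by (force simp: ke)
      have "sqn (peval q y *\<^sub>v \<xi>) \<le> B\<^sup>2 * sqn \<xi> + \<epsilon>" using bspec[OF q(2), of k] k by (auto simp: ke T'_def)
      moreover have "peval q y = f y" if "y \<in> ?W"
        using eq[OF dsum_additive_peval[OF W] fW q(1)] that yT by blast
      ultimately show ?thesis using yT by (auto simp: good_def ke g_def)
    qed
    ultimately have "g \<in> K T" unfolding K_def by blast
    then show ?thesis by blast
  qed
  obtain g where lim: "\<And>T C. finite T \<Longrightarrow> T \<subseteq> \<T> \<Longrightarrow> K T \<subseteq> C \<Longrightarrow> closed C \<Longrightarrow> g \<in> C"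
  proof (rule directed_limit[of X \<T> K])
    show "compact X" unfolding X_def by (rule compact_bounded_functions)
    show "K T \<noteq> {}" if "finite T" "T \<subseteq> \<T>" for T using K_nonempty that .
    show "K T \<subseteq> X" for T by (auto simp: K_def)
    show "K T' \<subseteq> K T" if "T \<subseteq> T'" for T T' using that unfolding K_def by blast
  qed blast
  define \<phi> where "\<phi> x = mat (lvl x) (lvl x) (\<lambda>(i, j). g (x, i, j))" for x
  have \<phi>_carrier: "\<phi> x \<in> carrier_mat (lvl x) (lvl x)" for x by (simp add: \<phi>_def)
  have cont: "continuous_on UNIV (\<lambda>h. h k)" for k :: "'d nc_point \<times> nat \<times> nat"
    by (rule continuous_on_product_coordinates)
  \<comment> \<open>The zero vector imposes no norm condition, so this test only ties the values at \<open>y\<close> to a polynomial.\<close>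
  have test: "(y, 0\<^sub>v (lvl y), 1) \<in> \<T>" if "y \<in> ?G" for y using that by (simp add: \<T>_def)
  have \<phi>_vec: "sqn (\<phi> x *\<^sub>v \<xi>) \<le> B\<^sup>2 * sqn \<xi>" if x: "x \<in> ?G" and \<xi>: "\<xi> \<in> carrier_vec (lvl x)" for x \<xi>
  proof (rule field_le_epsilon)
    fix \<epsilon> :: real assume \<epsilon>: "0 < \<epsilon>"
    let ?Q = "\<lambda>h. \<Sum>i<lvl x. (cmod (\<Sum>j<lvl x. h (x, i, j) * \<xi> $ j))\<^sup>2"
    have "g \<in> {h. ?Q h \<le> B\<^sup>2 * sqn \<xi> + \<epsilon>}"
    proof (rule lim[of "{(x, \<xi>, \<epsilon>)}"])
      show "closed {h. ?Q h \<le> B\<^sup>2 * sqn \<xi> + \<epsilon>}"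
        by (intro closed_Collect_le continuous_intros cont)
      show "K {(x, \<xi>, \<epsilon>)} \<subseteq> {h. ?Q h \<le> B\<^sup>2 * sqn \<xi> + \<epsilon>}"
      proof
        fix h assume "h \<in> K {(x, \<xi>, \<epsilon>)}"
        then obtain q where q: "good q h (x, \<xi>, \<epsilon>)" by (auto simp: K_def)
        have "?Q h = sqn (peval q x *\<^sub>v \<xi>)"
          using q \<xi> unfolding sqn_def good_def
          by (auto simp: index_mult_vec_sum[of _ "lvl x" "lvl x"] simp del: index_mult_mat_vec intro!: sum.cong)
        then show "h \<in> {h. ?Q h \<le> B\<^sup>2 * sqn \<xi> + \<epsilon>}" using q by (simp add: good_def)
      qed
    qed (use x \<xi> \<epsilon> in \<open>auto simp: \<T>_def\<close>)
    moreover have "?Q g = sqn (\<phi> x *\<^sub>v \<xi>)"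
      using \<xi> unfolding sqn_def
      by (auto simp: \<phi>_def index_mult_vec_sum[of _ "lvl x" "lvl x"] simp del: index_mult_mat_vec intro!: sum.cong)
    ultimately show "sqn (\<phi> x *\<^sub>v \<xi>) \<le> B\<^sup>2 * sqn \<xi> + \<epsilon>" by simp
  qed
  have f_carrier: "f x \<in> carrier_mat (lvl x) (lvl x)" if "x \<in> ?W" for x
    using fW that by (simp add: dsum_additive_def)
  have \<phi>_ext: "\<phi> x = f x" if x: "x \<in> ?W" for x
  proof (rule eq_matI)
    note fx = f_carrier[OF x]
    fix i j assume "i < dim_row (f x)" "j < dim_col (f x)"
    then have ij: "i < lvl x" "j < lvl x" using fx by auto
    have "g \<in> {h. h (x, i, j) = f x $$ (i, j)}"
    proof (rule lim[of "{(x, 0\<^sub>v (lvl x), 1)}"])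
      show "closed {h. h (x, i, j) = f x $$ (i, j)}" by (intro closed_Collect_eq continuous_intros cont)
      show "K {(x, 0\<^sub>v (lvl x), 1)} \<subseteq> {h. h (x, i, j) = f x $$ (i, j)}"
        using x ij by (auto simp: K_def good_def)
    qed (use x test in auto)
    then show "\<phi> x $$ (i, j) = f x $$ (i, j)" using ij by (simp add: \<phi>_def)
  qed (use carrier_matD[OF f_carrier[OF x]] in \<open>simp_all add: \<phi>_def\<close>)
  have \<phi>_dsum: "\<phi> (nc_dsum x y) = mat_dsum (\<phi> x) (\<phi> y)" if x: "x \<in> ?G" and y: "y \<in> ?G" for x y
  proof (rule eq_matI)
    define n m where "n = lvl x" and "m = lvl y"
    have xy: "nc_dsum x y \<in> ?G" "lvl (nc_dsum x y) = n + m"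
      using nc_setD(3,4)[OF G x y] by (auto simp: n_def m_def)
    note xl = nc_setD(2)[OF G x, folded n_def] and yl = nc_setD(2)[OF G y, folded m_def]
    note xyl = nc_dsum_level[OF xl yl]
    fix i j assume "i < dim_row (mat_dsum (\<phi> x) (\<phi> y))" "j < dim_col (mat_dsum (\<phi> x) (\<phi> y))"
    then have ij: "i < n + m" "j < n + m" by (auto simp: \<phi>_def n_def m_def)
    define S where "S = {h :: 'd nc_point \<times> nat \<times> nat \<Rightarrow> complex. h (nc_dsum x y, i, j) =
      (if i < n then (if j < n then h (x, i, j) else 0) else if j < n then 0 else h (y, i - n, j - n))}"
    have "g \<in> S"
    proof (rule lim[of "{(x, 0\<^sub>v (lvl x), 1), (y, 0\<^sub>v (lvl y), 1), (nc_dsum x y, 0\<^sub>v (lvl (nc_dsum x y)), 1)}"])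
      show "closed S"
        unfolding S_def
        by (cases "i < n"; cases "j < n"; simp; intro closed_Collect_eq continuous_intros cont)
      show "K {(x, 0\<^sub>v (lvl x), 1), (y, 0\<^sub>v (lvl y), 1), (nc_dsum x y, 0\<^sub>v (lvl (nc_dsum x y)), 1)} \<subseteq> S"
        using ij by (auto simp: K_def good_def S_def xy poly_eval_dsum[OF xl yl] mat_dsum_index[of _ n n _ m m]
            n_def[symmetric] m_def[symmetric])
    qed (use test[OF x] test[OF y] test[OF xy(1)] in auto)
    then show "\<phi> (nc_dsum x y) $$ (i, j) = mat_dsum (\<phi> x) (\<phi> y) $$ (i, j)"
      using ij \<phi>_carrier[of x] \<phi>_carrier[of y]
      by (subst mat_dsum_index[of _ n n _ m m]) (auto simp: S_def \<phi>_def xy n_def[symmetric] m_def[symmetric])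
  qed (use nc_setD(4)[OF G x y] in \<open>auto simp: \<phi>_def\<close>)
  have \<phi>_sim: "\<phi> (\<lambda>i. t * x i * s) = t * \<phi> x * s"
    if s: "s \<in> carrier_mat n n" and t: "t \<in> carrier_mat n n" and st: "s * t = 1\<^sub>m n" "t * s = 1\<^sub>m n"
      and x: "x \<in> ?G" "x \<in> nc_level n" and y: "(\<lambda>i. t * x i * s) \<in> ?G" "(\<lambda>i. t * x i * s) \<in> nc_level n" for n s t x
  proof (rule eq_matI)
    let ?y = "\<lambda>i. t * x i * s"
    have l: "lvl x = n" "lvl ?y = n" using lvl_eq x y by auto
    have idx: "(t * a * s) $$ (i, j) = (\<Sum>b<n. (\<Sum>k<n. t $$ (i, k) * a $$ (k, b)) * s $$ (b, j))"
      if a: "a \<in> carrier_mat n n" and ij: "i < n" "j < n" for a i j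
    proof -
      have "(t * a * s) $$ (i, j) = (\<Sum>b<n. (t * a) $$ (i, b) * s $$ (b, j))"
        by (rule index_mult_sum[OF mult_carrier_mat[OF t a] s ij])
      also have "\<dots> = (\<Sum>b<n. (\<Sum>k<n. t $$ (i, k) * a $$ (k, b)) * s $$ (b, j))"
        by (intro sum.cong refl arg_cong2[of _ _ _ _ "(*)"] index_mult_sum[OF t a ij(1)]) simp
      finally show ?thesis .
    qed
    fix i j assume "i < dim_row (t * \<phi> x * s)" "j < dim_col (t * \<phi> x * s)"
    then have ij: "i < n" "j < n" using s t by auto
    define S where "S = {h :: 'd nc_point \<times> nat \<times> nat \<Rightarrow> complex. h (?y, i, j) =
      (\<Sum>b<n. (\<Sum>k<n. t $$ (i, k) * h (x, k, b)) * s $$ (b, j))}"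
    have "g \<in> S"
    proof (rule lim[of "{(x, 0\<^sub>v (lvl x), 1), (?y, 0\<^sub>v (lvl ?y), 1)}"])
      show "closed S"
        unfolding S_def by (intro closed_Collect_eq continuous_intros cont)
      show "K {(x, 0\<^sub>v (lvl x), 1), (?y, 0\<^sub>v (lvl ?y), 1)} \<subseteq> S"
      proof
        fix h assume "h \<in> K {(x, 0\<^sub>v (lvl x), 1), (?y, 0\<^sub>v (lvl ?y), 1)}"
        then obtain q where q: "\<forall>i<n. \<forall>j<n. h (x, i, j) = poly_eval n q x $$ (i, j)"
          "\<forall>i<n. \<forall>j<n. h (?y, i, j) = poly_eval n q ?y $$ (i, j)"
          by (auto simp: K_def good_def l)
        have "h (?y, i, j) = (t * poly_eval n q x * s) $$ (i, j)"
          using q(2) ij unfolding poly_eval_similar[OF x(2) s t st] by blast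
        also have "\<dots> = (\<Sum>b<n. (\<Sum>k<n. t $$ (i, k) * h (x, k, b)) * s $$ (b, j))"
          unfolding idx[OF poly_eval_carrier(1) ij] using q(1) by simp
        finally show "h \<in> S" by (simp add: S_def)
      qed
    qed (use test[OF x(1)] test[OF y(1)] in auto)
    moreover have "(t * \<phi> x * s) $$ (i, j) = (\<Sum>b<n. (\<Sum>k<n. t $$ (i, k) * g (x, k, b)) * s $$ (b, j))"
      using idx[of "\<phi> x" i j] ij \<phi>_carrier[of x] by (simp add: l \<phi>_def)
    ultimately show "\<phi> ?y $$ (i, j) = (t * \<phi> x * s) $$ (i, j)"
      using ij by (simp add: S_def \<phi>_def l)
  qed (use s t lvl_eq[OF y(2)] in \<open>auto simp: \<phi>_def\<close>)
  show ?thesis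
  proof (rule that)
    show "nc_function_on ?G \<phi>"
      unfolding nc_function_on_def graded_on_def
    proof (intro conjI allI impI ballI)
      fix n :: nat and x assume "x \<in> ?G \<inter> nc_level n"
      then show "\<phi> x \<in> carrier_mat n n" using \<phi>_carrier[of x] lvl_eq[of x n] by simp
    next
      fix x y assume "x \<in> ?G \<and> y \<in> ?G \<and> nc_dsum x y \<in> ?G"
      then show "\<phi> (nc_dsum x y) = mat_dsum (\<phi> x) (\<phi> y)" using \<phi>_dsum by blast
    next
      fix n s t x
      assume s: "s \<in> carrier_mat n n" and t: "t \<in> carrier_mat n n"
        and a: "inverts_mat s t \<and> inverts_mat t s \<and> x \<in> ?G \<inter> nc_level n \<and> (\<lambda>i. t * x i * s) \<in> ?G \<inter> nc_level n"
      have "s * t = 1\<^sub>m n" "t * s = 1\<^sub>m n" using a s t by (auto simp: inverts_mat_def)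
      then show "\<phi> (\<lambda>i. t * x i * s) = t * \<phi> x * s" using \<phi>_sim[OF s t] a by blast
    qed
    show "\<phi> x = f x" if "x \<in> ?W" for x using \<phi>_ext[OF that] .
    show "mat_opnorm (\<phi> x) \<le> B" if "x \<in> ?G" for x
      unfolding mat_opnorm_le_iff[OF B] using \<phi>_vec[OF that] \<phi>_carrier[of x] by simp
  qed
qed

theorem theorem1p5:
  fixes A :: "'d::finite free_poly set"
    and \<delta> :: "'d free_poly mat"
    and J :: nat
    and f :: "'d nc_point \<Rightarrow> complex mat"
  assumes "nc_subalgebra A"
    and "J \<ge> 1" and "\<delta> \<in> carrier_mat J J"
    and "free_variety A \<inter> basic_free_set \<delta> \<noteq> {}"
    and "free_holomorphic_rel (free_variety A) (basic_free_set \<delta>) f"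
    and "nc_bounded_on (free_variety A \<inter> basic_free_set \<delta>) f"
  shows "\<exists>\<phi>\<in>Hinf (basic_free_set \<delta>).
           (\<forall>x\<in>free_variety A \<inter> basic_free_set \<delta>. \<phi> x = f x)
           \<and> Hinf_norm (basic_free_set \<delta>) \<phi>
               = (SUP x\<in>free_variety A \<inter> basic_free_set \<delta>. mat_opnorm (f x))"
proof -
  let ?W = "free_variety A \<inter> basic_free_set \<delta>" and ?G = "basic_free_set \<delta>"
  let ?B = "SUP x\<in>?W. mat_opnorm (f x)"
  have bdd: "bdd_above ((\<lambda>x. mat_opnorm (f x)) ` ?W)" using assms(6) by (simp add: nc_bounded_on_def)
  have le: "mat_opnorm (f x) \<le> ?B" if "x \<in> ?W" for x using cSUP_upper[OF that bdd] .
  obtain \<phi> where nc: "nc_function_on ?G \<phi>" and ext: "\<And>x. x \<in> ?W \<Longrightarrow> \<phi> x = f x"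
    and bound: "\<And>x. x \<in> ?G \<Longrightarrow> mat_opnorm (\<phi> x) \<le> ?B"
    using bounded_nc_extension[OF assms(3,2) free_holomorphic_rel_nc_function[OF assms(3,2,5)] le assms(4)]
    by blast
  have bddG: "bdd_above ((\<lambda>x. mat_opnorm (\<phi> x)) ` ?G)" using bound by (intro bdd_aboveI2[of _ _ ?B])
  have basic: "basic_free_open ?G" using assms(2,3) by (auto simp: basic_free_open_def)
  then have "openin free_topology ?G"
    unfolding free_topology_def by (intro topology_generated_by_Basis) simp
  then have "\<phi> \<in> Hinf ?G"
    using basic nc bddG by (auto simp: Hinf_def free_holomorphic_on_def nc_bounded_on_def)
  moreover have "Hinf_norm ?G \<phi> = ?B"
    unfolding Hinf_norm_def
  proof (rule antisym)
    show "(SUP x\<in>?G. mat_opnorm (\<phi> x)) \<le> ?B"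
      using assms(4) bound by (intro cSUP_least) auto
    show "?B \<le> (SUP x\<in>?G. mat_opnorm (\<phi> x))"
    proof (rule cSUP_least[OF assms(4)])
      fix x assume x: "x \<in> ?W"
      then show "mat_opnorm (f x) \<le> (SUP x\<in>?G. mat_opnorm (\<phi> x))"
        using cSUP_upper[OF _ bddG, of x] ext[OF x] by simp
    qed
  qed
  ultimately show ?thesis using ext by blast
qed

end
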